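(* Let $\theta>0$. Let $A_1,A_2,\dots$ be an arbitrary sequence of random multisubsets of $(0,1]$, with associated ranked sequences $L(1),L(2),\dots$ of elements, and let $T_n=\sum_{a\in A_n}a$ (sum taken with multiplicities). Suppose that $$\mathbb{P}(T_n\le 1)=1\quad\text{for every } n,$$ and that for some real numbers $\alpha,\beta$ with $\alpha+\beta=1-\theta$ it is the case that, for every $k\ge 1$ and every collection of pairwise disjoint closed intervals $I_i=[a_i,b_i]\subset(0,1]$, $i=1,\dots,k$, satisfying $b_1+\cdots+b_k<1$, we have $$\liminf_{n\to\infty}\ \mathbb{E}\prod_{i=1}^k|A_n\cap I_i|\ \ge\ \frac{\theta^k}{(1-a_1-\cdots-a_k)^{\alpha}(1-b_1-\cdots-b_k)^{\beta}}\prod_{i=1}^k\frac{b_i-a_i}{b_i}.$$ Then, as $n\to\infty$, $L(n)$ converges in distribution to the Poisson-Dirichlet process with parameter $\theta$. Moreover, the same conclusion holds if, in place of the last displayed inequality, one assumes (for all the same collections of intervals) $$\liminf_{n\to\infty}\ \mathbb{E}\prod_{i=1}^k|A_n\cap I_i|\ \ge\ \frac{\theta^k}{(1-a_1-\cdots-a_k)^{\alpha}(1-b_1-\cdots-b_k)^{\beta}}\prod_{i=1}^k\log\frac{b_i}{a_i}.$$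
   Context: Random multisubsets: a multisubset $A$ of $(0,1]$ assigns to each $u\in(0,1]$ a finite nonnegative integer multiplicity; only at most countable multisets are considered. For $S\subset(0,1]$, $|A\cap S|$ denotes the cardinality of the intersection counted with multiplicities (possibly infinite, but finite for singletons). A random multisubset $A$ is specified by the joint distributions of $|A\cap S_1|,\dots,|A\cap S_k|$ for finite collections of Borel sets $S_i\subset(0,1]$ (equivalently, it is a random $\sigma$-finite integer-valued measure on $(0,1]$). Ranked sequence: $L(n)=(L_1(n),L_2(n),\dots)$, where $L_i(n)$ is the $i$-th largest element of $A_n$ (counting multiplicities) if $i\le|A_n|$, and $L_i(n)=0$ if $i>|A_n|$. Poisson-Dirichlet process PD($\theta$), $\theta>0$: let $U_1,U_2,\dots$ be independent uniform random variables on $(0,1)$, $V_i=U_i^{1/\theta}$, and $G_1=1-V_1$, $G_2=V_1(1-V_2)$, $G_3=V_1V_2(1-V_3),\dots$. Then PD($\theta$) is the distribution of the sequence $L_1\ge L_2\ge\cdots$ obtained by sorting $G_1,G_2,\dots$ into descending order. (Equivalently, it is the Poisson point process with intensity $\theta\,dx/x$ on $(0,1)$ conditioned on the sum of the arrivals being $1$.) Convergence in distribution of sequences means convergence in distribution of the first $k$ coordinates for every $k$. *)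

theory Defs
  imports "HOL-Probability.Probability"
begin

(* A multiset of reals is given by its multiplicity function u |-> m u. *)

definition multisubset :: "(real \<Rightarrow> nat) \<Rightarrow> bool" where
  "multisubset m \<longleftrightarrow> {u. m u \<noteq> 0} \<subseteq> {0<..1} \<and> countable {u. m u \<noteq> 0}"

definition mcount :: "(real \<Rightarrow> nat) \<Rightarrow> real set \<Rightarrow> ennreal" where
  "mcount m S = (\<integral>\<^sup>+u. of_nat (m u) \<partial>count_space S)"

definition msum :: "(real \<Rightarrow> nat) \<Rightarrow> ennreal" where
  "msum m = (\<integral>\<^sup>+u. ennreal u * of_nat (m u) \<partial>count_space {0<..1})"

definition random_multisubset :: "'w measure \<Rightarrow> ('w \<Rightarrow> real \<Rightarrow> nat) \<Rightarrow> bool" where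
  "random_multisubset M A \<longleftrightarrow>
     (\<forall>\<omega>\<in>space M. multisubset (A \<omega>)) \<and>
     (\<forall>S\<in>sets borel. S \<subseteq> {0<..1} \<longrightarrow> (\<lambda>\<omega>. mcount (A \<omega>) S) \<in> borel_measurable M)"

(* Sequences are indexed from 0: ranked m i is the (i+1)-st largest element of m
   with multiplicity, i.e. the element x with at most i elements strictly above it
   and at least i+1 elements at or above it.  A multiset with infinitely many elements in
   some [e,1], e > 0, need not have such elements; it is sent to the zero sequence.
   This never happens if the sum of the elements is finite. *)

definition ranked :: "(real \<Rightarrow> nat) \<Rightarrow> nat \<Rightarrow> real" where
  "ranked m i =
     (if (\<forall>e>0. mcount m {e..1} < \<infinity>) \<and> of_nat (Suc i) \<le> mcount m {0<..1}
      then (THE x. x \<in> {0<..1} \<and> 0 < m x \<and>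
              mcount m {x<..1} < of_nat (Suc i) \<and> of_nat (Suc i) \<le> mcount m {x..1})
      else 0)"

(* The multiset of values in (0,1] of a sequence.  Values taken infinitely often get
   multiplicity 0; for the stick-breaking sequence below these have probability 0. *)

definition seq_multiset :: "(nat \<Rightarrow> real) \<Rightarrow> real \<Rightarrow> nat" where
  "seq_multiset g x = (if x \<in> {0<..1} then card {i. g i = x} else 0)"

definition stick_breaking :: "real \<Rightarrow> (nat \<Rightarrow> real) \<Rightarrow> nat \<Rightarrow> real" where
  "stick_breaking \<theta> u i = (\<Prod>j<i. u j powr (1 / \<theta>)) * (1 - u i powr (1 / \<theta>))"

definition poisson_dirichlet :: "real \<Rightarrow> (nat \<Rightarrow> real) measure" where
  "poisson_dirichlet \<theta> =
     distr (\<Pi>\<^sub>M i\<in>UNIV. uniform_measure lborel {0<..<1}) (\<Pi>\<^sub>M i\<in>UNIV. borel)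
       (\<lambda>u. ranked (seq_multiset (stick_breaking \<theta> u)))"

(* Bounded continuous functions on R^k are represented as bounded continuous functions of
   the whole sequence (product topology) that depend on the first k coordinates only. *)

definition seq_weak_conv :: "(nat \<Rightarrow> (nat \<Rightarrow> real) measure) \<Rightarrow> (nat \<Rightarrow> real) measure \<Rightarrow> bool" where
  "seq_weak_conv \<mu> \<nu> \<longleftrightarrow>
     (\<forall>k. \<forall>f :: (nat \<Rightarrow> real) \<Rightarrow> real.
        continuous_on UNIV f \<and> bounded (range f) \<and>
        (\<forall>x y. (\<forall>i<k. x i = y i) \<longrightarrow> f x = f y) \<longrightarrow>
        (\<lambda>n. integral\<^sup>L (\<mu> n) f) \<longlonglongrightarrow> integral\<^sup>L \<nu> f)"

definition admissible_intervals :: "nat \<Rightarrow> (nat \<Rightarrow> real) \<Rightarrow> (nat \<Rightarrow> real) \<Rightarrow> bool" where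
  "admissible_intervals k a b \<longleftrightarrow>
     (\<forall>i<k. 0 < a i \<and> a i \<le> b i \<and> b i \<le> 1) \<and>
     disjoint_family_on (\<lambda>i. {a i..b i}) {..<k} \<and>
     (\<Sum>i<k. b i) < 1"

end

theory Submission
  imports Defs
begin

text \<open>
  Let \<open>F = f \<circ> ranked\<close> with \<open>f\<close> continuous, bounded and nonnegative.  It suffices that
  \<open>liminf E F(A n) \<ge> E F(PD)\<close>; applied to \<open>C + f\<close> and \<open>C - f\<close> this gives convergence.
  Pick \<open>k\<close> elements of \<open>A n\<close> in size-biased order.  The probability of picking values near
  \<open>x\<^sub>1, \<dots>, x\<^sub>k\<close> is \<open>\<Prod>i. x\<^sub>i / (1 - x\<^sub>1 - \<dots> - x\<^sub>i\<^sub>-\<^sub>1)\<close> times the expected number of \<open>k\<close>-tuples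
  there, so by hypothesis its lower limit is at least the density of the first \<open>k\<close> stick-breaking
  lengths.  That is a probability density, and when the picked values have sum close to 1 they
  determine the ranked sequence up to a small error.  The argument is carried out on the boxes of a
  grid, whose mesh tends to 0 before \<open>k\<close> tends to infinity; both limits are Fatou's lemma.
\<close>

section \<open>Counting and ranking\<close>

text \<open>No random selection is ever constructed. It is replaced by a pathwise inequality: for
  one fixed multiset the selection weights, with every element rounded down to the lower end of its
  cell, add up to at most 1 over all boxes. Since the hypothesis speaks of disjoint intervals only,
  a box always uses \<open>k\<close> different cells; selections with two elements in one cell are
  discarded. Nothing is lost in the limit, because stick-breaking lengths are almost surely distinct
  and a fine grid separates them. The condition \<alpha> + \<beta> = 1 - \<theta> is what matches
  the two densities: on a small box around \<open>x\<close> the two powers in the hypothesis merge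
  into a power of 1 - \<Sum>x with exponent \<theta> - 1, which is exactly the power in the joint
  density of the first \<open>k\<close> stick-breaking lengths. What connects \<open>A n\<close>
  with the limit is the infimum of \<open>F\<close> over all multisets that have elements in the
  given cells. It depends on the box alone, so it can be taken out of both expectations.\<close>

lemma mcount_eq_emeasure:
  "mcount m S = emeasure (density (count_space UNIV) (\<lambda>u. of_nat (m u))) S"
  unfolding mcount_def
  by (subst emeasure_density) (auto simp: nn_integral_count_space_indicator)

lemma mcount_mono: "S \<subseteq> T \<Longrightarrow> mcount m S \<le> mcount m T"
  unfolding mcount_eq_emeasure by (rule emeasure_mono) auto

lemma mcount_cong: "(\<And>u. m u \<noteq> 0 \<Longrightarrow> u \<in> S \<longleftrightarrow> u \<in> T) \<Longrightarrow> mcount m S = mcount m T"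
  unfolding mcount_def by (rule nn_integral_count_space_eq) auto

lemma mcount_eq_0_iff: "mcount m S = 0 \<longleftrightarrow> (\<forall>u\<in>S. m u = 0)"
  unfolding mcount_def by (subst nn_integral_0_iff_AE) (auto simp: AE_count_space)

lemma mcount_ge_1:
  assumes "mcount m S \<noteq> 0"
  shows "1 \<le> mcount m S"
proof -
  obtain u where u: "u \<in> S" "m u \<noteq> 0"
    using assms mcount_eq_0_iff by blast
  have "1 \<le> (of_nat (m u) :: ennreal)"
    using u(2) by (simp add: Suc_leI)
  also have "\<dots> \<le> mcount m S"
    unfolding mcount_def using u(1) by (rule nn_integral_ge_point)
  finally show ?thesis .
qed

lemma sum_le_nn_integral_count_space:
  fixes f :: "'a \<Rightarrow> ennreal"
  assumes "finite X" "X \<subseteq> S"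
  shows "(\<Sum>u\<in>X. f u) \<le> (\<integral>\<^sup>+u. f u \<partial>count_space S)"
proof -
  have "(\<Sum>u\<in>X. f u) = (\<integral>\<^sup>+u. f u * indicator X u \<partial>count_space S)"
    using assms by (subst nn_integral_count_space'[of X]) (auto intro!: sum.cong)
  also have "\<dots> \<le> (\<integral>\<^sup>+u. f u \<partial>count_space S)"
    by (intro nn_integral_mono) (auto simp: indicator_def)
  finally show ?thesis .
qed

lemma finite_support_if_mcount_finite:
  assumes "mcount m S < \<infinity>"
  shows "finite {u\<in>S. m u \<noteq> 0}"
proof -
  have "emeasure (count_space {u\<in>S. m u \<noteq> 0}) {u\<in>S. m u \<noteq> 0}
      = (\<integral>\<^sup>+u. 1 \<partial>count_space {u\<in>S. m u \<noteq> 0})"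
    by simp
  also have "\<dots> \<le> (\<integral>\<^sup>+u. of_nat (m u) \<partial>count_space {u\<in>S. m u \<noteq> 0})"
    by (intro nn_integral_mono) (auto simp: Suc_leI)
  also have "\<dots> \<le> mcount m S"
    by (fold mcount_def, rule mcount_mono) auto
  finally show ?thesis
    using assms by (auto simp: emeasure_count_space split: if_splits)
qed

section \<open>Locally finite multisets and their ranked sequences\<close>

definition locally_finite :: "(real \<Rightarrow> nat) \<Rightarrow> bool" where
  "locally_finite m \<longleftrightarrow> (\<forall>e>0. mcount m {e..1} < \<infinity>)"

text \<open>Markov's inequality: each element of size at least \<open>e\<close> contributes at least
  \<open>e\<close> to the sum.\<close>

lemma locally_finite_if_msum_finite:
  assumes "msum m < \<infinity>"
  shows "locally_finite m"
  unfolding locally_finite_def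
proof safe
  fix e :: real assume e: "e > 0"
  have "ennreal e * mcount m {e..1} = (\<integral>\<^sup>+u. ennreal e * of_nat (m u) \<partial>count_space {e..1})"
    unfolding mcount_def by (simp add: nn_integral_cmult)
  also have "\<dots> \<le> (\<integral>\<^sup>+u. ennreal u * of_nat (m u) \<partial>count_space {e..1})"
    by (intro nn_integral_mono mult_right_mono) (auto intro: ennreal_leI)
  also have "\<dots> \<le> msum m"
    unfolding msum_def using e
    by (subst (1 2) nn_integral_count_space_indicator, simp, simp, intro nn_integral_mono)
       (auto simp: indicator_def)
  finally have "ennreal e * mcount m {e..1} < \<infinity>"
    using assms by auto
  then show "mcount m {e..1} < \<infinity>"
    using e by (auto simp: ennreal_mult_less_top)
qed

text \<open>The intervals [1/(n+1), 1] increase to (0, 1], so the counts converge to the full count.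
  Counts are integers: being below \<open>Suc i\<close> means being at most \<open>i\<close>, and
  this weaker bound survives the supremum.\<close>

lemma exists_mcount_ge:
  assumes "of_nat (Suc i) \<le> mcount m {0<..1}"
  shows "\<exists>e>0. of_nat (Suc i) \<le> mcount m {e..1}"
proof (rule ccontr)
  assume "\<not> ?thesis"
  then have lt: "mcount m {e..1} < of_nat (Suc i)" if "e > 0" for e
    using that by force
  let ?I = "\<lambda>n. {1 / real (Suc n)..1}"
  have bound: "mcount m (?I n) \<le> of_nat i" for n
  proof (cases "mcount m (?I n)")
    case top
    then show ?thesis using lt[of "1 / real (Suc n)"] by simp
  next
    case (real r)
    have fin: "finite {u\<in>?I n. m u \<noteq> 0}"
      using real by (intro finite_support_if_mcount_finite) simp
    have "mcount m (?I n) = (\<Sum>u | u \<in> ?I n \<and> m u \<noteq> 0. of_nat (m u))"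
      unfolding mcount_def using fin by (intro nn_integral_count_space') auto
    then obtain N where N: "mcount m (?I n) = of_nat N"
      by (metis of_nat_sum)
    then have "(of_nat N :: ennreal) < of_nat (Suc i)"
      using lt[of "1 / real (Suc n)"] by simp
    then have "N \<le> i"
      by (simp only: of_nat_less_iff less_Suc_eq_le)
    then show ?thesis
      unfolding N by simp
  qed
  have un: "(\<Union>n. ?I n) = {0<..1}"
  proof safe
    fix x :: real assume "x \<in> {0<..1}"
    then show "x \<in> (\<Union>n. ?I n)"
      using reals_Archimedean[of x] by (auto simp: inverse_eq_divide intro: less_imp_le)
  next
    fix x n assume "x \<in> ?I n"
    moreover have "0 < 1 / real (Suc n)" by simp
    ultimately show "x \<in> {0<..1}" unfolding atLeastAtMost_iff greaterThanAtMost_iff by linarith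
  qed
  have "mcount m {0<..1} = (SUP n. mcount m (?I n))"
    unfolding un[symmetric] mcount_eq_emeasure
    by (subst SUP_emeasure_incseq) (auto simp: incseq_def frac_le intro: order_trans[rotated])
  also have "\<dots> \<le> of_nat i"
    using bound by (intro SUP_least)
  finally have "(of_nat (Suc i) :: ennreal) \<le> of_nat i"
    using assms by (rule order_trans[rotated])
  then show False
    by (simp only: of_nat_le_iff)
qed

text \<open>The definite description has a witness: among the finitely many elements in [e, 1], the
  largest \<open>u\<close> for which [u, 1] already holds \<open>i + 1\<close> elements. It is
  unique because for v < w the interval [w, 1] lies in (v, 1], and the two counts would contradict
  each other.\<close>

lemma ranked_spec:
  assumes m: "multisubset m" and fin: "locally_finite m"
    and i: "of_nat (Suc i) \<le> mcount m {0<..1}"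
  shows "ranked m i \<in> {0<..1} \<and> mcount m {ranked m i<..1} < of_nat (Suc i) \<and>
    of_nat (Suc i) \<le> mcount m {ranked m i..1}"
proof -
  let ?P = "\<lambda>x. x \<in> {0<..1} \<and> 0 < m x \<and>
              mcount m {x<..1} < of_nat (Suc i) \<and> of_nat (Suc i) \<le> mcount m {x..1}"
  obtain e where e: "e > 0" "of_nat (Suc i) \<le> mcount m {e..1}"
    using exists_mcount_ge[OF i] by blast
  define S where "S = {u\<in>{e..1}. m u \<noteq> 0}"
  have finS: "finite S"
    unfolding S_def using fin e(1) unfolding locally_finite_def
    by (intro finite_support_if_mcount_finite) blast
  have neS: "S \<noteq> {}"
  proof
    assume "S = {}"
    then have "mcount m {e..1} = 0"
      by (auto simp: mcount_eq_0_iff S_def)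
    then show False using e(2) by (simp add: order_le_less)
  qed
  define T where "T = {u\<in>S. of_nat (Suc i) \<le> mcount m {u..1}}"
  have "mcount m {Min S..1} = mcount m {e..1}"
  proof (rule mcount_cong)
    fix u assume u: "m u \<noteq> 0"
    have "e \<le> Min S" using Min_in[OF finS neS] by (auto simp: S_def)
    moreover have "Min S \<le> u" if "u \<in> {e..1}"
      using that u finS by (intro Min_le) (auto simp: S_def)
    ultimately show "u \<in> {Min S..1} \<longleftrightarrow> u \<in> {e..1}" by auto
  qed
  then have "Min S \<in> T"
    using Min_in[OF finS neS] e(2) by (auto simp: T_def)
  then have neT: "T \<noteq> {}" and finT: "finite T"
    using finS by (auto simp: T_def)
  define x where "x = Max T"
  have xT: "x \<in> T" unfolding x_def by (rule Max_in[OF finT neT])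
  have "mcount m {x<..1} < of_nat (Suc i)"
  proof (cases "S \<inter> {x<..} = {}")
    case True
    have "m u = 0" if "u \<in> {x<..1}" for u
    proof (rule ccontr)
      assume "m u \<noteq> 0"
      then have "u \<in> S \<inter> {x<..}" using that xT by (auto simp: S_def T_def)
      then show False using True by simp
    qed
    then have "mcount m {x<..1} = 0"
      by (auto simp: mcount_eq_0_iff)
    then show ?thesis by (metis of_nat_0 of_nat_less_iff zero_less_Suc)
  next
    case False
    define x' where "x' = Min (S \<inter> {x<..})"
    have x': "x' \<in> S" "x < x'"
      using Min_in[OF _ False] finS by (auto simp: x'_def)
    have "x' \<notin> T"
      using Max_ge[OF finT, of x'] x'(2) by (auto simp: x_def)
    then have "mcount m {x'..1} < of_nat (Suc i)"
      using x'(1) by (auto simp: T_def)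
    \<comment> \<open>There is no element strictly between \<open>x\<close> and the next element
      \<open>x'\<close>, so the open interval above \<open>x\<close> holds the same elements as the
      closed one from \<open>x'\<close>.\<close>
    moreover have "mcount m {x'..1} = mcount m {x<..1}"
    proof (rule mcount_cong)
      fix u assume u: "m u \<noteq> 0"
      have "x' \<le> u" if "u \<in> {x<..1}"
        unfolding x'_def using that u finS xT by (intro Min_le) (auto simp: S_def T_def)
      then show "u \<in> {x'..1} \<longleftrightarrow> u \<in> {x<..1}" using x'(2) by auto
    qed
    ultimately show ?thesis by simp
  qed
  then have Px: "?P x"
    using xT e(1) by (auto simp: T_def S_def)
  have "y = x" if "?P y" for y
  proof (rule ccontr)
    assume "y \<noteq> x"
    have no: False if "?P v" "?P w" "v < w" for v w
    proof -
      have "mcount m {w..1} \<le> mcount m {v<..1}"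
        using that(3) by (intro mcount_mono) auto
      then show False using that(1,2) by (meson leD order_trans)
    qed
    show False
      using \<open>y \<noteq> x\<close> no[of x y] no[of y x] Px that by (meson linorder_neqE_linordered_idom)
  qed
  then have "(THE x. ?P x) = x"
    using Px by (rule the_equality[rotated])
  then have "ranked m i = x"
    using i fin unfolding ranked_def locally_finite_def by simp
  then show ?thesis using Px by simp
qed

lemma ranked_eq_0: "\<not> locally_finite m \<or> \<not> of_nat (Suc i) \<le> mcount m {0<..1} \<Longrightarrow> ranked m i = 0"
  by (auto simp: ranked_def locally_finite_def)

lemma ranked_bounds:
  assumes "multisubset m"
  shows "0 \<le> ranked m i" "ranked m i \<le> 1"
  using ranked_spec[OF assms, of i] ranked_eq_0[of m i] by force+

text \<open>Describes superlevel sets of a ranked entry by counts. Measurability and the comparison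
  of two ranked sequences both rest on this form instead of on the definite description.\<close>

lemma le_ranked_iff:
  assumes m: "multisubset m" and y: "0 < y"
  shows "y \<le> ranked m i \<longleftrightarrow> locally_finite m \<and> of_nat (Suc i) \<le> mcount m {y..1}"
proof (cases "locally_finite m \<and> of_nat (Suc i) \<le> mcount m {0<..1}")
  case True
  note * = ranked_spec[OF m conjunct1[OF True] conjunct2[OF True]]
  show ?thesis
  proof (cases "y \<le> ranked m i")
    case T: True
    then have "mcount m {ranked m i..1} \<le> mcount m {y..1}"
      by (intro mcount_mono) auto
    with * True T show ?thesis by (meson order_trans)
  next
    case F: False
    then have "mcount m {y..1} \<le> mcount m {ranked m i<..1}"
      by (intro mcount_mono) auto
    with * True F show ?thesis by (meson leD order_trans)
  qed
next
  case False
  have "mcount m {y..1} \<le> mcount m {0<..1}"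
    using y by (intro mcount_mono) auto
  with False ranked_eq_0[of m i] y show ?thesis
    by (auto dest: order_trans)
qed

text \<open>The elements of \<open>m\<close> other than \<open>x 0, \<dots>, x (k - 1)\<close> sum to at most \<open>\<epsilon>\<close>, so every
  element above \<open>\<epsilon>\<close> is one of the \<open>x i\<close> and has a counterpart in \<open>m'\<close>.\<close>

lemma ranked_diff_le:
  fixes x x' :: "nat \<Rightarrow> real"
  assumes m: "multisubset m" "msum m \<le> 1" and m': "multisubset m'" "msum m' \<le> 1"
    and x: "inj_on x {..<k}" "\<And>i. i < k \<Longrightarrow> m (x i) \<noteq> 0"
    and x': "inj_on x' {..<k}" "\<And>i. i < k \<Longrightarrow> m' (x' i) \<noteq> 0"
    and sum: "(\<Sum>i<k. x i) \<ge> 1 - \<epsilon>"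
    and close: "\<And>i. i < k \<Longrightarrow> \<bar>x i - x' i\<bar> \<le> \<epsilon>"
    and \<epsilon>: "\<epsilon> \<ge> 0"
  shows "ranked m i \<le> ranked m' i + \<epsilon>"
proof (rule ccontr)
  define y where "y = ranked m i"
  assume "\<not> ?thesis"
  then have y: "y > ranked m' i + \<epsilon>" by (simp add: y_def)
  then have y\<epsilon>: "y > \<epsilon>" using ranked_bounds[OF m'(1), of i] by simp
  have ge: "of_nat (Suc i) \<le> mcount m {y..1}"
    using le_ranked_iff[OF m(1), of y i] y\<epsilon> \<epsilon> by (simp add: y_def)
  let ?X = "x ` {..<k}"
  have supp: "m u \<noteq> 0 \<Longrightarrow> u \<in> {0<..1}" "m' u \<noteq> 0 \<Longrightarrow> u \<in> {0<..1}" for u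
    using m(1) m'(1) by (auto simp: multisubset_def)
  \<comment> \<open>An element \<open>u\<close> above \<epsilon> that is not listed, or is listed
    but has multiplicity 2 or more, would add more than \<epsilon> to a listed sum of at least 1 -
    \<epsilon>, pushing the total above 1.\<close>
  have le1: "m u \<le> (if u \<in> ?X then 1 else 0)" if u: "u \<ge> y" "u \<le> 1" for u
  proof (rule ccontr)
    assume c: "\<not> ?thesis"
    have u0: "m u \<noteq> 0" using c by (auto split: if_splits)
    have u': "u \<in> {0<..1}" using u y\<epsilon> \<epsilon> by auto
    have "(\<Sum>v\<in>?X. v) + u \<le> (\<Sum>v\<in>insert u ?X. v * real (m v))"
    proof (cases "u \<in> ?X")
      case True
      have "(\<Sum>v\<in>?X. v) + u = (\<Sum>v\<in>?X. v + (if v = u then u else 0))"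
        using True by (simp add: sum.distrib)
      also have "\<dots> \<le> (\<Sum>v\<in>?X. v * real (m v))"
      proof (rule sum_mono)
        fix v assume v: "v \<in> ?X"
        then have "m v \<noteq> 0" using x(2) by auto
        then have v0: "v > 0" "real (m v) \<ge> 1" using supp(1)[of v] by auto
        show "v + (if v = u then u else 0) \<le> v * real (m v)"
        proof (cases "v = u")
          case True
          then have "real (m v) \<ge> 2" using c v by simp
          then have "v * 2 \<le> v * real (m v)" using v0 by (intro mult_left_mono) auto
          then show ?thesis using True by simp
        next
          case False
          then show ?thesis using v0 by simp
        qed
      qed
      finally show ?thesis using True by (simp add: insert_absorb)
    next
      case False
      have "(\<Sum>v\<in>?X. v) \<le> (\<Sum>v\<in>?X. v * real (m v))"
      proof (rule sum_mono)
        fix v assume v: "v \<in> ?X"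
        then have "m v \<noteq> 0" using x(2) by auto
        then have v0: "v > 0" "real (m v) \<ge> 1" using supp(1)[of v] by auto
        then show "v \<le> v * real (m v)" by simp
      qed
      moreover have "u \<le> u * real (m u)" using u0 u' by simp
      ultimately show ?thesis using False by simp
    qed
    moreover have "(\<Sum>v\<in>insert u ?X. v * real (m v)) \<le> 1"
    proof -
      have sub: "insert u ?X \<subseteq> {0<..1}" using u' x(2) supp by auto
      have "ennreal (\<Sum>v\<in>insert u ?X. v * real (m v)) = (\<Sum>v\<in>insert u ?X. ennreal (v * real (m v)))"
        using sub by (intro sum_ennreal[symmetric]) (auto simp del: sum.insert)
      also have "\<dots> = (\<Sum>v\<in>insert u ?X. ennreal v * of_nat (m v))"
        using sub by (intro sum.cong refl) (auto simp: ennreal_mult ennreal_of_nat_eq_real_of_nat)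
      also have "\<dots> \<le> msum m"
        unfolding msum_def using sub by (intro sum_le_nn_integral_count_space) auto
      also have "\<dots> \<le> ennreal 1" using m(2) by simp
      finally show ?thesis by (subst (asm) ennreal_le_iff) simp_all
    qed
    moreover have "(\<Sum>v\<in>?X. v) = (\<Sum>i<k. x i)"
      using x(1) by (simp add: sum.reindex)
    ultimately show False using sum u y\<epsilon> by linarith
  qed
  \<comment> \<open>The listed elements at or above \<open>y\<close> are all elements of
    \<open>m\<close> there, so \<open>R\<close> has at least \<open>i + 1\<close> members. Their
    counterparts in \<open>m'\<close> are distinct and lie at or above
    \<open>y - \<epsilon>\<close>.\<close>
  define R where "R = {j. j < k \<and> x j \<ge> y}"
  have [simp]: "finite R" by (simp add: R_def)
  have "mcount m {y..1} \<le> (\<integral>\<^sup>+u. indicator (x ` R) u \<partial>count_space {y..1})"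
    unfolding mcount_def
  proof (intro nn_integral_mono)
    fix u assume u: "u \<in> space (count_space {y..1})"
    have "m u \<le> (if u \<in> x ` R then 1 else 0)"
      using le1[of u] u by (auto simp: R_def split: if_splits)
    then show "(of_nat (m u) :: ennreal) \<le> indicator (x ` R) u"
      by (auto simp: indicator_def split: if_splits)
  qed
  also have "\<dots> = (\<integral>\<^sup>+u. indicator (x ` R) u * indicator {y..1} u \<partial>count_space UNIV)"
    by (simp add: nn_integral_count_space_indicator)
  also have "\<dots> \<le> (\<integral>\<^sup>+u. indicator (x ` R) u \<partial>count_space UNIV)"
    by (intro nn_integral_mono) (auto simp: indicator_def)
  also have "\<dots> = of_nat (card R)"
    using x(1) by (subst nn_integral_indicator)
      (auto simp: emeasure_count_space R_def intro!: card_image inj_on_subset[OF x(1)])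
  also have "\<dots> = of_nat (card (x' ` R))"
    using x'(1) by (subst card_image) (auto simp: R_def intro!: inj_on_subset[OF x'(1)])
  also have "\<dots> = (\<Sum>u\<in>x' ` R. 1)" by simp
  also have "\<dots> \<le> (\<Sum>u\<in>x' ` R. of_nat (m' u))"
    using x'(2) by (intro sum_mono) (auto simp: R_def Suc_leI)
  also have "\<dots> \<le> mcount m' {y - \<epsilon>..1}"
    unfolding mcount_def
  proof (intro sum_le_nn_integral_count_space)
    show "x' ` R \<subseteq> {y - \<epsilon>..1}"
    proof safe
      fix j assume "j \<in> R"
      then have j: "j < k" "x j \<ge> y" by (auto simp: R_def)
      show "x' j \<in> {y - \<epsilon>..1}"
        using close[OF j(1)] j supp(2)[OF x'(2)[OF j(1)]] by auto
    qed
  qed simp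
  finally have "of_nat (Suc i) \<le> mcount m' {y - \<epsilon>..1}" using ge by simp
  moreover have "locally_finite m'"
    using m'(2) by (intro locally_finite_if_msum_finite) (auto simp: order_le_less_trans)
  ultimately have "y - \<epsilon> \<le> ranked m' i"
    using le_ranked_iff[OF m'(1), of "y - \<epsilon>" i] y\<epsilon> by simp
  then show False using y by simp
qed

text \<open>By \<open>le_ranked_iff\<close> every superlevel set is an event about counts. Local
  finiteness is tested along 1/(n+1) only, which makes it a countable intersection.\<close>

lemma ranked_measurable:
  assumes meas: "\<And>S. S \<in> sets borel \<Longrightarrow> S \<subseteq> {0<..1} \<Longrightarrow> (\<lambda>\<omega>. mcount (A \<omega>) S) \<in> borel_measurable M"
    and ms: "\<And>\<omega>. \<omega> \<in> space M \<Longrightarrow> multisubset (A \<omega>)"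
  shows "(\<lambda>\<omega>. ranked (A \<omega>)) \<in> measurable M (\<Pi>\<^sub>M i\<in>UNIV. borel)"
proof (rule measurable_PiM_single')
  fix i
  have [measurable]: "(\<lambda>\<omega>. mcount (A \<omega>) {y..1}) \<in> borel_measurable M" if "y > 0" for y
    using that by (intro meas) auto
  have lf: "locally_finite m \<longleftrightarrow> (\<forall>n. mcount m {1 / real (Suc n)..1} < \<infinity>)" for m
  proof
    assume *: "\<forall>n. mcount m {1 / real (Suc n)..1} < \<infinity>"
    show "locally_finite m" unfolding locally_finite_def
    proof safe
      fix e :: real assume "e > 0"
      then obtain n where "1 / real (Suc n) < e"
        using reals_Archimedean by (auto simp: inverse_eq_divide)
      then have "mcount m {e..1} \<le> mcount m {1 / real (Suc n)..1}"
        by (intro mcount_mono) auto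
      then show "mcount m {e..1} < \<infinity>" using * by (meson order_le_less_trans)
    qed
  qed (auto simp: locally_finite_def)
  show "(\<lambda>\<omega>. ranked (A \<omega>) i) \<in> borel_measurable M"
  proof (rule borel_measurableI_ge)
    fix y
    show "{\<omega> \<in> space M. y \<le> ranked (A \<omega>) i} \<in> sets M"
    proof (cases "y > 0")
      case True
      then have "{\<omega> \<in> space M. y \<le> ranked (A \<omega>) i}
        = {\<omega> \<in> space M. (\<forall>n. mcount (A \<omega>) {1 / real (Suc n)..1} < \<infinity>) \<and> of_nat (Suc i) \<le> mcount (A \<omega>) {y..1}}"
        using ms by (auto simp: le_ranked_iff lf)
      also have "\<dots> \<in> sets M"
        using True by measurable
      finally show ?thesis .
    next
      case False
      then have "{\<omega> \<in> space M. y \<le> ranked (A \<omega>) i} = space M"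
        using ranked_bounds(1)[OF ms, of _ i] by force
      then show ?thesis by simp
    qed
  qed
qed (auto simp: space_PiM)

section \<open>Size-biased selection\<close>

text \<open>The denominators use total mass 1. For a multiset whose sum is smaller than 1 the true
  size-biased probabilities are larger, so these weights err on the safe side.\<close>

definition pick_weight :: "nat \<Rightarrow> (nat \<Rightarrow> real) \<Rightarrow> real" where
  "pick_weight k x = (\<Prod>i<k. x i / (1 - (\<Sum>l<i. x l)))"

definition distinct_tuples :: "nat \<Rightarrow> 'c set \<Rightarrow> (nat \<Rightarrow> 'c) set" where
  "distinct_tuples k C = {j \<in> {..<k} \<rightarrow>\<^sub>E C. inj_on j {..<k}}"

lemma finite_distinct_tuples: "finite C \<Longrightarrow> finite (distinct_tuples k C)"
  unfolding distinct_tuples_def by (intro finite_subset[OF _ finite_PiE[of "{..<k}" "\<lambda>_. C"]]) auto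

lemma sum_pick_weight_le_1:
  fixes a n :: "'c \<Rightarrow> real"
  assumes C: "finite C" and a: "\<And>c. c \<in> C \<Longrightarrow> 0 < a c"
    and n: "\<And>c. c \<in> C \<Longrightarrow> n c = 0 \<or> 1 \<le> n c"
    and total: "(\<Sum>c\<in>C. a c * n c) \<le> 1"
  shows "(\<Sum>j | j \<in> distinct_tuples k C \<and> (\<Sum>i<k. a (j i)) < 1.
            pick_weight k (a \<circ> j) * (\<Prod>i<k. n (j i))) \<le> 1"
proof (induction k)
  case 0
  have "{j. j \<in> distinct_tuples 0 C \<and> (\<Sum>i<0. a (j i)) < 1} = {\<lambda>_. undefined}"
    by (auto simp: distinct_tuples_def)
  then show ?case by (simp add: pick_weight_def)
next
  case (Suc k)
  let ?J = "\<lambda>k. {j. j \<in> distinct_tuples k C \<and> (\<Sum>i<k. a (j i)) < 1}"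
  let ?D = "SIGMA j:?J k. C - j ` {..<k}"
  let ?up = "\<lambda>(j, c). j(k := c)"
  let ?g = "\<lambda>k j. pick_weight k (a \<circ> j) * (\<Prod>i<k. n (j i))"
  have fin: "finite (?J k)" for k
    using finite_distinct_tuples[OF C] by auto
  have jC: "j i \<in> C" if "j \<in> ?J k" "i < k" for i j k
    using that by (auto simp: distinct_tuples_def)
  have n0: "n c \<ge> 0" if "c \<in> C" for c using n[OF that] by auto
  have lt1: "(\<Sum>l<i. a (j l)) < 1" if "j \<in> ?J k" "i \<le> k" for i j
  proof -
    have "(\<Sum>l<i. a (j l)) \<le> (\<Sum>l<k. a (j l))"
    proof (intro sum_mono2)
      fix l assume "l \<in> {..<k} - {..<i}"
      then show "0 \<le> a (j l)" using a[OF jC[OF that(1), of l]] by simp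
    qed (use that(2) in auto)
    then show ?thesis using that(1) by (blast intro: le_less_trans)
  qed
  have g0: "?g k j \<ge> 0" if "j \<in> ?J k" for j
  proof -
    have "0 \<le> a (j i) / (1 - (\<Sum>l<i. a (j l)))" if "i < k" for i
    proof (rule divide_nonneg_nonneg)
      show "0 \<le> a (j i)" using a[OF jC[OF \<open>j \<in> ?J k\<close> that]] by simp
      show "0 \<le> 1 - (\<Sum>l<i. a (j l))" using lt1[OF \<open>j \<in> ?J k\<close>, of i] that by simp
    qed
    moreover have "0 \<le> n (j i)" if "i < k" for i
      using n0[OF jC[OF \<open>j \<in> ?J k\<close> that]] .
    ultimately show ?thesis
      unfolding pick_weight_def by (intro mult_nonneg_nonneg prod_nonneg) auto
  qed
  have g_up: "?g (Suc k) (j(k := c)) = ?g k j * (a c * n c / (1 - (\<Sum>l<k. a (j l))))" for j c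
  proof -
    have "pick_weight (Suc k) (a \<circ> j(k := c)) = pick_weight k (a \<circ> j) * (a c / (1 - (\<Sum>l<k. a (j l))))"
    proof -
      have "(\<Sum>l<i. (a \<circ> j(k := c)) l) = (\<Sum>l<i. (a \<circ> j) l)" if "i \<le> k" for i
        using that by (intro sum.cong) auto
      then show ?thesis
        unfolding pick_weight_def prod.lessThan_Suc by (intro arg_cong2[of _ _ _ _ times] prod.cong) auto
    qed
    moreover have "(\<Prod>i<Suc k. n ((j(k := c)) i)) = (\<Prod>i<k. n (j i)) * n c"
      by simp
    ultimately show ?thesis by simp
  qed
  have inj: "inj_on ?up ?D"
  proof (rule inj_onI)
    fix p p' assume p: "p \<in> ?D" "p' \<in> ?D" "?up p = ?up p'"
    obtain j c j' c' where pp: "p = (j, c)" "p' = (j', c')" by (meson surj_pair)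
    have *: "j \<in> distinct_tuples k C" "j' \<in> distinct_tuples k C" "j(k := c) = j'(k := c')"
      using p(1,2) unfolding pp distinct_tuples_def mem_Sigma_iff mem_Collect_eq
        apply (blast, blast)
      using p(3) unfolding pp by (simp only: prod.case)
    have "c = c'" using fun_cong[OF *(3), of k] by simp
    moreover have "j = j'"
    proof
      fix i show "j i = j' i"
      proof (cases "i = k")
        case True
        \<comment> \<open>Tuples of length \<open>k\<close> are extensional, so the value at
          position \<open>k\<close> overwritten by the update carried no information.\<close>
        have "h k = undefined" if "h \<in> distinct_tuples k C" for h
          using that unfolding distinct_tuples_def by (auto intro: PiE_arb)
        from this[OF *(1)] this[OF *(2)] True show ?thesis by simp
      next
        case False
        then show ?thesis using fun_cong[OF *(3), of i] by simp
      qed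
    qed
    ultimately show "p = p'" by (simp add: pp)
  qed
  have sub: "?J (Suc k) \<subseteq> ?up ` ?D"
  proof
    fix j assume j: "j \<in> ?J (Suc k)"
    define j' where "j' = restrict j {..<k}"
    have inj: "inj_on j {..<Suc k}" using j by (simp add: distinct_tuples_def)
    have j': "j' i = j i" if "i < k" for i
      using that by (simp add: j'_def)
    have im: "j' ` {..<k} = j ` {..<k}"
      using j' by (intro image_cong) simp_all
    have "inj_on j' {..<k}"
      unfolding j'_def inj_on_restrict_eq by (rule inj_on_subset[OF inj]) simp
    moreover have "j' \<in> {..<k} \<rightarrow>\<^sub>E C"
      unfolding j'_def restrict_PiE_iff using jC[OF j] by simp
    moreover have "(\<Sum>i<k. a (j' i)) = (\<Sum>i<k. a (j i))"
      using j' by (intro sum.cong) simp_all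
    moreover have "(\<Sum>i<k. a (j i)) < 1"
      using j a[OF jC[OF j, of k]] by simp
    moreover have "j k \<notin> j ` {..<k}"
      using inj_on_image_mem_iff[OF inj, of k "{..<k}"] by simp
    ultimately have D: "(j', j k) \<in> ?D"
      unfolding mem_Sigma_iff mem_Collect_eq im distinct_tuples_def using jC[OF j, of k] by simp
    have "j = j'(k := j k)"
    proof
      fix i
      have "j i = undefined" if "i \<notin> {..<Suc k}"
        using j that unfolding distinct_tuples_def by (auto intro: PiE_arb)
      then show "j i = (j'(k := j k)) i"
        by (cases "i < k"; cases "i = k") (auto simp: j'_def)
    qed
    then have "j = ?up (j', j k)" unfolding prod.case .
    then show "j \<in> ?up ` ?D" using D by (rule image_eqI)
  qed
  have "(\<Sum>j\<in>?J (Suc k). ?g (Suc k) j) \<le> (\<Sum>j\<in>?up ` ?D. ?g (Suc k) j)"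
  proof (intro sum_mono2 sub)
    show "finite (?up ` ?D)" using fin C by auto
    fix j assume "j \<in> ?up ` ?D - ?J (Suc k)"
    then obtain j' c where *: "j' \<in> ?J k" "c \<in> C" "j = j'(k := c)" by auto
    have "0 \<le> ?g k j' * (a c * n c / (1 - (\<Sum>l<k. a (j' l))))"
      using g0[OF *(1)] a[OF *(2)] n0[OF *(2)] lt1[OF *(1), of k]
      by (intro mult_nonneg_nonneg[of "?g k j'"] divide_nonneg_nonneg) simp_all
    then show "0 \<le> ?g (Suc k) j" unfolding *(3) g_up .
  qed
  also have "\<dots> = (\<Sum>p\<in>?D. ?g (Suc k) (?up p))"
    by (simp only: sum.reindex[OF inj] o_def)
  also have "\<dots> = (\<Sum>j\<in>?J k. \<Sum>c\<in>C - j ` {..<k}. ?g (Suc k) (j(k := c)))"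
    using fin C by (subst sum.Sigma) (auto intro!: sum.cong)
  also have "\<dots> \<le> (\<Sum>j\<in>?J k. ?g k j)"
  proof (rule sum_mono)
    fix j assume j: "j \<in> ?J k"
    let ?s = "\<Sum>l<k. a (j l)"
    have s: "?s < 1" using j by simp
    have eq: "(\<Sum>c\<in>C - j ` {..<k}. ?g (Suc k) (j(k := c)))
      = ?g k j * ((\<Sum>c\<in>C - j ` {..<k}. a c * n c) / (1 - ?s))"
      unfolding g_up by (simp add: sum_distrib_left sum_divide_distrib)
    show "(\<Sum>c\<in>C - j ` {..<k}. ?g (Suc k) (j(k := c))) \<le> ?g k j"
    \<comment> \<open>An empty cell in the tuple contributes to \<open>s\<close> but not to the
      mass, so the mass argument breaks down; in that case the weight of the tuple is 0 anyway.
      Otherwise every \<open>n (j i)\<close> is at least 1.\<close>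
    proof (cases "\<exists>i<k. n (j i) = 0")
      case True
      then have "(\<Prod>i<k. n (j i)) = 0" by (auto intro!: prod_zero)
      then show ?thesis
        unfolding eq by (simp only: mult_zero_right mult_zero_left order_refl)
    next
      case False
      have "?s \<le> (\<Sum>i<k. a (j i) * n (j i))"
      proof (rule sum_mono)
        fix i assume "i \<in> {..<k}"
        then show "a (j i) \<le> a (j i) * n (j i)"
          using n[OF jC[OF j, of i]] a[OF jC[OF j, of i]] False by auto
      qed
      also have "\<dots> = (\<Sum>c\<in>j ` {..<k}. a c * n c)"
        using j by (subst sum.reindex) (auto simp: distinct_tuples_def)
      finally have "?s + (\<Sum>c\<in>C - j ` {..<k}. a c * n c) \<le> (\<Sum>c\<in>C. a c * n c)"
        using jC[OF j] by (subst (2) sum.subset_diff[of "j ` {..<k}"]) (auto simp: C)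
      then have "(\<Sum>c\<in>C - j ` {..<k}. a c * n c) / (1 - ?s) \<le> 1"
        using s total by simp
      then show ?thesis unfolding eq using g0[OF j] by (intro mult_left_le)
    qed
  qed
  also have "\<dots> \<le> 1" by (rule Suc.IH)
  finally show ?case .
qed

section \<open>Stick breaking\<close>

abbreviation unif :: "real measure" where
  "unif \<equiv> uniform_measure lborel {0<..<1}"

abbreviation unif_seq :: "(nat \<Rightarrow> real) measure" where
  "unif_seq \<equiv> \<Pi>\<^sub>M i\<in>UNIV. unif"

lemma prob_space_unif: "prob_space unif"
  by (rule prob_space_uniform_measure) auto

interpretation unif_seq: sequence_space unif
  using prob_space_unif
  by (simp add: sequence_space_def product_prob_space_def product_sigma_finite_def
      product_prob_space_axioms_def prob_space_imp_sigma_finite)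

interpretation unif_pair: pair_sigma_finite unif unif_seq
  by unfold_locales

section \<open>The joint law of the first pieces\<close>

lemma nn_integral_unif_seq_shift:
  assumes [measurable]: "h \<in> borel_measurable unif_seq"
  shows "(\<integral>\<^sup>+\<omega>. h \<omega> \<partial>unif_seq) = (\<integral>\<^sup>+x. \<integral>\<^sup>+\<omega>. h (case_nat x \<omega>) \<partial>unif_seq \<partial>unif)"
proof -
  have "(\<integral>\<^sup>+\<omega>. h \<omega> \<partial>unif_seq)
      = (\<integral>\<^sup>+\<omega>. h \<omega> \<partial>distr (unif \<Otimes>\<^sub>M unif_seq) unif_seq (\<lambda>(s, \<omega>). case_nat s \<omega>))"
    by (simp only: unif_seq.PiM_iter)
  also have "\<dots> = (\<integral>\<^sup>+p. h (case p of (s, \<omega>) \<Rightarrow> case_nat s \<omega>) \<partial>(unif \<Otimes>\<^sub>M unif_seq))"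
    by (rule nn_integral_distr) measurable
  also have "\<dots> = (\<integral>\<^sup>+x. \<integral>\<^sup>+\<omega>. h (case (x, \<omega>) of (s, \<omega>) \<Rightarrow> case_nat s \<omega>) \<partial>unif_seq \<partial>unif)"
    by (rule unif_seq.nn_integral_fst[symmetric]) measurable
  finally show ?thesis by simp
qed

lemma AE_unif: "AE x in unif. 0 < x \<and> x < 1"
  by (rule AE_uniform_measureI) auto

lemma stick_breaking_0: "stick_breaking \<theta> (case_nat x \<omega>) 0 = 1 - x powr (1 / \<theta>)"
  by (simp add: stick_breaking_def)

text \<open>Self-similarity: the later breaks act on the remaining stick as the original ones act on
  the unit stick. As the shifted sequence of uniforms has the same law and is independent of the
  first one, this drives the inductions below.\<close>

lemma stick_breaking_Suc:
  "stick_breaking \<theta> (case_nat x \<omega>) (Suc i) = x powr (1 / \<theta>) * stick_breaking \<theta> \<omega> i"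
  unfolding stick_breaking_def by (subst prod.lessThan_Suc_shift) (simp add: algebra_simps)

lemma measurable_stick_breaking [measurable]:
  "(\<lambda>u. stick_breaking \<theta> u i) \<in> borel_measurable (\<Pi>\<^sub>M i\<in>UNIV. borel)"
  unfolding stick_breaking_def by measurable

text \<open>With v = \<open>x powr (1 / \<theta>)\<close> the variable v has density \<theta>
  v^(\<theta> - 1) on (0, 1), and the weight is v^(1 - \<theta>). They cancel, leaving \<theta>
  times the length of [p, q]; an inequality remains because [p, q] may stick out of (0, 1).\<close>

lemma nn_integral_unif_power_le:
  assumes \<theta>: "\<theta> > 0" and pq: "0 < p" "p \<le> q"
  shows "(\<integral>\<^sup>+x. indicator {p..q} (x powr (1 / \<theta>)) * ennreal (x powr (1 / \<theta> - 1)) \<partial>unif)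
    \<le> ennreal (\<theta> * (q - p))"
proof -
  let ?g = "\<lambda>x. x powr (1 / \<theta> - 1)"
  have "(\<integral>\<^sup>+x. indicator {p..q} (x powr (1 / \<theta>)) * ennreal (?g x) \<partial>unif)
    = (\<integral>\<^sup>+x. indicator {p..q} (x powr (1 / \<theta>)) * ennreal (?g x) * indicator {0<..<1} x \<partial>lborel)"
    by (subst nn_integral_uniform_measure) (auto simp: divide_ennreal_def)
  also have "\<dots> \<le> (\<integral>\<^sup>+x. ennreal (?g x) * indicator {p powr \<theta>..q powr \<theta>} x \<partial>lborel)"
  proof (intro nn_integral_mono)
    fix x :: real
    have "x \<in> {p powr \<theta>..q powr \<theta>}" if "x > 0" "x powr (1 / \<theta>) \<in> {p..q}"
    proof -
      have x: "x = (x powr (1 / \<theta>)) powr \<theta>" using that \<theta> by (simp add: powr_powr)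
      have "p powr \<theta> \<le> (x powr (1 / \<theta>)) powr \<theta>" "(x powr (1 / \<theta>)) powr \<theta> \<le> q powr \<theta>"
        using that pq \<theta> by (auto intro!: powr_mono2)
      then show ?thesis using x by simp
    qed
    then show "indicator {p..q} (x powr (1 / \<theta>)) * ennreal (?g x) * indicator {0<..<1} x
      \<le> ennreal (?g x) * indicator {p powr \<theta>..q powr \<theta>} x"
      by (auto simp: indicator_def)
  qed
  also have "\<dots> = ennreal (\<theta> * (q powr \<theta>) powr (1 / \<theta>) - \<theta> * (p powr \<theta>) powr (1 / \<theta>))"
  proof (rule nn_integral_FTC_Icc)
    fix x assume "x \<in> {p powr \<theta>..q powr \<theta>}"
    then have x: "x > 0" using pq by (intro less_le_trans[of 0 "p powr \<theta>" x]) auto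
    show "((\<lambda>x. \<theta> * x powr (1 / \<theta>)) has_real_derivative ?g x) (at x)"
      using x \<theta> by (auto intro!: derivative_eq_intros)
  qed (use pq \<theta> in \<open>auto intro!: powr_mono2\<close>)
  also have "(q powr \<theta>) powr (1 / \<theta>) = q" using pq \<theta> by (simp add: powr_powr)
  also have "(p powr \<theta>) powr (1 / \<theta>) = p" using pq \<theta> by (simp add: powr_powr)
  finally show ?thesis by (simp add: right_diff_distrib)
qed

text \<open>The bound is the volume of the box times an upper bound of the density
  \<open>\<theta>^k r^(-\<theta>) (r - \<Sum>x)^(\<theta>-1) \<Prod>i\<in>{1..<k}. 1 / (r - \<Sum>l<i. x l)\<close> of the first \<open>k\<close>
  pieces of a stick of length \<open>r\<close>.\<close>

lemma stick_breaking_box_le: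
  fixes a b :: "nat \<Rightarrow> real"
  assumes \<theta>: "\<theta> > 0"
    and "r > 0" "\<And>i. i < k \<Longrightarrow> 0 \<le> a i \<and> a i \<le> b i" "(\<Sum>i<k. b i) < r"
    and "\<And>t. r - (\<Sum>i<k. b i) \<le> t \<Longrightarrow> t \<le> r - (\<Sum>i<k. a i) \<Longrightarrow> t powr (\<theta> - 1) \<le> Z"
  shows "(\<integral>\<^sup>+\<omega>. indicator {\<omega>. \<forall>i<k. r * stick_breaking \<theta> \<omega> i \<in> {a i..b i}} \<omega> \<partial>unif_seq)
    \<le> ennreal (\<theta> ^ k * r powr (1 - \<theta>) * Z * (\<Prod>i<k. (b i - a i) / (r - (\<Sum>j<i. b j))))"
  using assms(2-)
proof (induction k arbitrary: r a b)
  case 0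
  \<comment> \<open>With no pieces the range for \<open>t\<close> shrinks to \<open>t = r\<close>,
    so \<open>Z\<close> bounds \<open>r powr (\<theta> - 1)\<close>.\<close>
  have "1 = r powr (1 - \<theta>) * r powr (\<theta> - 1)"
    using 0 by (simp add: powr_add[symmetric])
  also have "\<dots> \<le> r powr (1 - \<theta>) * Z"
    using 0 by (intro mult_left_mono) auto
  finally show ?case
    using unif_seq.emeasure_space_1 by (simp add: space_PiM)
next
  case (Suc k)
  note r = \<open>r > 0\<close>
  have ab: "0 \<le> a i" "a i \<le> b i" if "i < Suc k" for i using Suc.prems(2)[OF that] by auto
  let ?a = "\<lambda>i. a (Suc i)" and ?b = "\<lambda>i. b (Suc i)"
  have sums: "(\<Sum>i<Suc n. a i) = a 0 + (\<Sum>i<n. ?a i)" "(\<Sum>i<Suc n. b i) = b 0 + (\<Sum>i<n. ?b i)" for n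
    by (simp_all only: sum.lessThan_Suc_shift)
  \<comment> \<open>The bound for the remaining pieces after the first break, without the power of
    the remaining length. The remaining length in the denominators is replaced by its least value
    \<open>r - b 0\<close>, so that \<open>K\<close> does not depend on where the first break
    fell.\<close>
  define K where "K = \<theta> ^ k * Z * (\<Prod>i<k. (?b i - ?a i) / (r - b 0 - (\<Sum>j<i. ?b j)))"
  have part: "(\<Sum>j<i. ?b j) \<le> (\<Sum>j<k. ?b j)" if "i \<le> k" for i
    using that order_trans[OF ab] by (intro sum_mono2) auto
  have part0: "0 \<le> (\<Sum>j<k. ?b j)"
    using part[of 0] by simp
  have Z0: "Z \<ge> 0"
  proof -
    have "(r - (\<Sum>i<Suc k. b i)) powr (\<theta> - 1) \<le> Z"
      using ab by (intro Suc.prems(4)) (auto intro!: sum_mono simp del: sum.lessThan_Suc)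
    then show ?thesis by (meson order_trans powr_ge_zero)
  qed
  have b0: "b 0 < r" using Suc.prems(3) part0 unfolding sums by linarith
  have K0: "K \<ge> 0"
  proof -
    have "0 \<le> (?b i - ?a i) / (r - b 0 - (\<Sum>j<i. ?b j))" if "i < k" for i
    proof (rule divide_nonneg_nonneg)
      show "0 \<le> ?b i - ?a i" using ab(2)[of "Suc i"] that by simp
      show "0 \<le> r - b 0 - (\<Sum>j<i. ?b j)"
        using part[of i] that Suc.prems(3) unfolding sums by linarith
    qed
    then show ?thesis
      unfolding K_def using \<theta> Z0 by (intro mult_nonneg_nonneg prod_nonneg) auto
  qed
  \<comment> \<open>The first piece \<open>r * (1 - V)\<close> lies in [a 0, b 0] exactly when
    \<open>V\<close> lies in [p, q].\<close>
  define p q where "p = 1 - b 0 / r" and "q = 1 - a 0 / r"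
  have pq: "0 < p" "p \<le> q" using b0 r ab[of 0] by (auto simp: p_def q_def divide_right_mono)
  let ?V = "\<lambda>x. x powr (1 / \<theta>)"
  let ?B = "{\<omega>. \<forall>i<Suc k. r * stick_breaking \<theta> \<omega> i \<in> {a i..b i}}"
  have step: "(\<integral>\<^sup>+\<omega>. indicator ?B (case_nat x \<omega>) \<partial>unif_seq)
      \<le> ennreal (K * r powr (1 - \<theta>)) * (indicator {p..q} (?V x) * ennreal (x powr (1 / \<theta> - 1)))"
    if x: "0 < x" for x
  proof (cases "r * (1 - ?V x) \<in> {a 0..b 0}")
    case False
    then have "indicator ?B (case_nat x \<omega>) = (0 :: ennreal)" for \<omega>
      by (auto simp: indicator_def stick_breaking_0 intro!: exI[of _ 0])
    then show ?thesis by simp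
  next
    case True
    let ?r = "r * ?V x"
    have r': "r - b 0 \<le> ?r" "?r \<le> r - a 0" using True by (auto simp: algebra_simps)
    have sub: "indicator ?B (case_nat x \<omega>)
        \<le> (indicator {\<omega>. \<forall>i<k. ?r * stick_breaking \<theta> \<omega> i \<in> {?a i..?b i}} \<omega> :: ennreal)" for \<omega>
    proof -
      have "\<omega> \<in> {\<omega>. \<forall>i<k. ?r * stick_breaking \<theta> \<omega> i \<in> {?a i..?b i}}" if "case_nat x \<omega> \<in> ?B"
        using that by (force simp: stick_breaking_Suc mult.assoc)
      then show ?thesis by (auto simp: indicator_def)
    qed
    have "(\<integral>\<^sup>+\<omega>. indicator ?B (case_nat x \<omega>) \<partial>unif_seq)
      \<le> (\<integral>\<^sup>+\<omega>. indicator {\<omega>. \<forall>i<k. ?r * stick_breaking \<theta> \<omega> i \<in> {?a i..?b i}} \<omega> \<partial>unif_seq)"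
      by (intro nn_integral_mono sub)
    also have "\<dots> \<le> ennreal (\<theta> ^ k * ?r powr (1 - \<theta>) * Z * (\<Prod>i<k. (?b i - ?a i) / (?r - (\<Sum>j<i. ?b j))))"
    proof (rule Suc.IH)
      show "?r > 0" using r x by simp
      show "0 \<le> ?a i \<and> ?a i \<le> ?b i" if "i < k" for i using ab[of "Suc i"] that by auto
      show "(\<Sum>i<k. ?b i) < ?r" using Suc.prems(3) r' unfolding sums by linarith
      \<comment> \<open>The remaining length lies between \<open>r - b 0\<close> and
        \<open>r - a 0\<close>, so the range of \<open>t\<close> for the shorter stick is contained
        in the original one and the same \<open>Z\<close> serves.\<close>
      show "t powr (\<theta> - 1) \<le> Z" if "?r - (\<Sum>i<k. ?b i) \<le> t" "t \<le> ?r - (\<Sum>i<k. ?a i)" for t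
        using that r' by (intro Suc.prems(4)) (auto simp only: sums)
    qed
    also have "\<dots> \<le> ennreal (K * ?r powr (1 - \<theta>))"
    proof (rule ennreal_leI)
      have "(\<Prod>i<k. (?b i - ?a i) / (?r - (\<Sum>j<i. ?b j))) \<le> (\<Prod>i<k. (?b i - ?a i) / (r - b 0 - (\<Sum>j<i. ?b j)))"
      proof (rule prod_mono)
        fix i assume "i \<in> {..<k}"
        then have i: "i < k" by simp
        have pos: "r - b 0 - (\<Sum>j<i. ?b j) > 0"
          using part[of i] i Suc.prems(3) unfolding sums by linarith
        have "(?b i - ?a i) / (?r - (\<Sum>j<i. ?b j)) \<le> (?b i - ?a i) / (r - b 0 - (\<Sum>j<i. ?b j))"
          using pos r' ab[of "Suc i"] i by (intro divide_left_mono mult_pos_pos) auto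
        moreover have "0 \<le> (?b i - ?a i) / (?r - (\<Sum>j<i. ?b j))"
          using pos r' ab[of "Suc i"] i by (intro divide_nonneg_nonneg) auto
        ultimately show "0 \<le> (?b i - ?a i) / (?r - (\<Sum>j<i. ?b j)) \<and>
          (?b i - ?a i) / (?r - (\<Sum>j<i. ?b j)) \<le> (?b i - ?a i) / (r - b 0 - (\<Sum>j<i. ?b j))" by simp
      qed
      then have "\<theta> ^ k * ?r powr (1 - \<theta>) * Z * (\<Prod>i<k. (?b i - ?a i) / (?r - (\<Sum>j<i. ?b j)))
        \<le> \<theta> ^ k * ?r powr (1 - \<theta>) * Z * (\<Prod>i<k. (?b i - ?a i) / (r - b 0 - (\<Sum>j<i. ?b j)))"
        using \<theta> Z0 by (intro mult_left_mono) auto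
      also have "\<dots> = K * ?r powr (1 - \<theta>)" by (simp add: K_def)
      finally show "\<theta> ^ k * ?r powr (1 - \<theta>) * Z * (\<Prod>i<k. (?b i - ?a i) / (?r - (\<Sum>j<i. ?b j)))
        \<le> K * ?r powr (1 - \<theta>)" .
    qed
    \<comment> \<open>The power of the remaining length splits off v^(1 - \<theta>) with v =
      \<open>x powr (1 / \<theta>)\<close>, the weight that cancels the density of v in
      \<open>nn_integral_unif_power_le\<close>.\<close>
    also have "?r powr (1 - \<theta>) = r powr (1 - \<theta>) * x powr (1 / \<theta> - 1)"
      using r x \<theta> by (simp add: powr_mult powr_powr diff_divide_distrib)
    also have "ennreal (K * (r powr (1 - \<theta>) * x powr (1 / \<theta> - 1)))
      = ennreal (K * r powr (1 - \<theta>)) * ennreal (x powr (1 / \<theta> - 1))"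
      using K0 by (subst ennreal_mult[symmetric]) (auto simp: mult.assoc)
    also have "?V x \<in> {p..q}"
      using True r by (auto simp: p_def q_def field_simps)
    then have "ennreal (x powr (1 / \<theta> - 1)) = indicator {p..q} (?V x) * ennreal (x powr (1 / \<theta> - 1))"
      by simp
    finally show ?thesis .
  qed
  have "(\<integral>\<^sup>+\<omega>. indicator ?B \<omega> \<partial>unif_seq) = (\<integral>\<^sup>+x. \<integral>\<^sup>+\<omega>. indicator ?B (case_nat x \<omega>) \<partial>unif_seq \<partial>unif)"
    by (rule nn_integral_unif_seq_shift) measurable
  also have "\<dots> \<le> (\<integral>\<^sup>+x. ennreal (K * r powr (1 - \<theta>)) *
      (indicator {p..q} (?V x) * ennreal (x powr (1 / \<theta> - 1))) \<partial>unif)"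
    using AE_unif by (intro nn_integral_mono_AE) (erule eventually_mono, rule step, simp)
  also have "\<dots> = ennreal (K * r powr (1 - \<theta>)) *
      (\<integral>\<^sup>+x. indicator {p..q} (?V x) * ennreal (x powr (1 / \<theta> - 1)) \<partial>unif)"
    by (rule nn_integral_cmult) measurable
  also have "\<dots> \<le> ennreal (K * r powr (1 - \<theta>)) * ennreal (\<theta> * (q - p))"
    by (intro mult_left_mono nn_integral_unif_power_le[OF \<theta> pq]) auto
  also have "\<dots> = ennreal (K * r powr (1 - \<theta>) * (\<theta> * (q - p)))"
    using K0 \<theta> pq by (intro ennreal_mult[symmetric]) auto
  also have "K * r powr (1 - \<theta>) * (\<theta> * (q - p)) =
      \<theta> ^ Suc k * r powr (1 - \<theta>) * Z * (\<Prod>i<Suc k. (b i - a i) / (r - (\<Sum>j<i. b j)))"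
  proof -
    have "q - p = (b 0 - a 0) / r" by (simp add: p_def q_def diff_divide_distrib)
    moreover have "(\<Prod>i<Suc k. (b i - a i) / (r - (\<Sum>j<i. b j)))
      = (b 0 - a 0) / r * (\<Prod>i<k. (?b i - ?a i) / (r - b 0 - (\<Sum>j<i. ?b j)))"
      unfolding prod.lessThan_Suc_shift sums by (simp add: diff_diff_eq)
    ultimately show ?thesis by (simp add: K_def)
  qed
  finally show ?case .
qed

section \<open>Almost sure properties: distinct pieces and total length one\<close>

lemma AE_unif_seq_shiftI:
  assumes P [measurable]: "Measurable.pred unif_seq P"
    and AE: "AE x in unif. AE \<omega> in unif_seq. P (case_nat x \<omega>)"
  shows "AE \<omega> in unif_seq. P \<omega>"
proof -
  have "AE \<omega> in distr (unif \<Otimes>\<^sub>M unif_seq) unif_seq (\<lambda>(s, \<omega>). case_nat s \<omega>). P \<omega>"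
  proof (subst AE_distr_iff)
    show "AE p in unif \<Otimes>\<^sub>M unif_seq. P (case p of (s, \<omega>) \<Rightarrow> case_nat s \<omega>)"
    proof (rule unif_pair.AE_pair_measure)
      show "AE x in unif. AE y in unif_seq. P (case (x, y) of (s, \<omega>) \<Rightarrow> case_nat s \<omega>)"
        using AE by simp
    qed measurable
  qed measurable
  then show ?thesis by (simp only: unif_seq.PiM_iter)
qed

lemma AE_unif_neq: "AE x in unif. x \<noteq> c"
  using AE_lborel_singleton[of c] by (intro AE_uniform_measureI) auto

lemma AE_unif_seq_range: "AE \<omega> in unif_seq. \<forall>i. 0 < \<omega> i \<and> \<omega> i < 1"
  unfolding AE_all_countable
  by (intro allI AE_PiM_component[OF prob_space_unif _ AE_unif]) simp

lemma pred_stick_breaking_eq [measurable]: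
  "Measurable.pred (\<Pi>\<^sub>M i\<in>UNIV. borel) (\<lambda>\<omega>. stick_breaking \<theta> \<omega> i = stick_breaking \<theta> \<omega> j)"
  unfolding pred_def by (rule borel_measurable_eq) measurable

lemma sum_stick_breaking:
  "(\<Sum>i<k. stick_breaking \<theta> \<omega> i) = 1 - (\<Prod>j<k. \<omega> j powr (1 / \<theta>))"
  by (induction k) (simp_all add: stick_breaking_def algebra_simps)

lemma stick_breaking_pos:
  assumes "\<theta> > 0" "\<And>i. 0 < \<omega> i \<and> \<omega> i < 1"
  shows "0 < stick_breaking \<theta> \<omega> i"
proof -
  have "\<omega> i powr (1 / \<theta>) < 1 powr (1 / \<theta>)"
    using assms by (intro powr_less_mono2) (auto intro: less_imp_le)
  moreover have "0 < \<omega> j powr (1 / \<theta>)" for j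
    using assms(2)[of j] by simp
  ultimately show ?thesis
    unfolding stick_breaking_def by (intro mult_pos_pos prod_pos) auto
qed

text \<open>Shifting reduces to the first piece. With the later uniforms fixed, the equation 1 - v =
  v g with v = \<open>x powr (1 / \<theta>)\<close> has at most one solution \<open>x\<close>, which
  is a null event for the first uniform; Fubini exchanges the two null-set statements.\<close>

lemma AE_stick_breaking_neq:
  assumes "\<theta> > 0" "i < l"
  shows "AE \<omega> in unif_seq. stick_breaking \<theta> \<omega> i \<noteq> stick_breaking \<theta> \<omega> l"
  using assms(2)
proof (induction i arbitrary: l)
  case 0
  then obtain l' where l: "l = Suc l'" by (cases l) auto
  have "AE x in unif. 1 - x powr (1 / \<theta>) \<noteq> x powr (1 / \<theta>) * g" for g
  proof (rule AE_mp[OF AE_unif AE_mp[OF AE_unif_neq]], intro AE_I2 impI)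
    fix x assume x: "x \<noteq> (1 / (1 + g)) powr \<theta>" "0 < x \<and> x < 1"
    show "1 - x powr (1 / \<theta>) \<noteq> x powr (1 / \<theta>) * g"
    proof
      assume "1 - x powr (1 / \<theta>) = x powr (1 / \<theta>) * g"
      then have *: "x powr (1 / \<theta>) * (1 + g) = 1" by (simp add: algebra_simps)
      then have "1 + g \<noteq> 0" by auto
      with * have "1 / (1 + g) = x powr (1 / \<theta>)" by (simp add: divide_eq_eq)
      then have "(1 / (1 + g)) powr \<theta> = x"
        using x(2) assms(1) by (simp add: powr_powr)
      then show False using x(1) by simp
    qed
  qed
  then have "AE \<omega> in unif_seq. AE x in unif. 1 - x powr (1 / \<theta>) \<noteq> x powr (1 / \<theta>) * stick_breaking \<theta> \<omega> l'"
    by simp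
  then have "AE x in unif. AE \<omega> in unif_seq. 1 - x powr (1 / \<theta>) \<noteq> x powr (1 / \<theta>) * stick_breaking \<theta> \<omega> l'"
    by (subst unif_pair.AE_commute) measurable
  then have "AE x in unif. AE \<omega> in unif_seq. stick_breaking \<theta> (case_nat x \<omega>) 0 \<noteq> stick_breaking \<theta> (case_nat x \<omega>) l"
    unfolding l stick_breaking_0 stick_breaking_Suc .
  then show ?case
    by (rule AE_unif_seq_shiftI[rotated]) measurable
next
  case (Suc i)
  then obtain l' where l: "l = Suc l'" "i < l'" by (cases l) auto
  have "AE x in unif. AE \<omega> in unif_seq.
      x powr (1 / \<theta>) * stick_breaking \<theta> \<omega> i \<noteq> x powr (1 / \<theta>) * stick_breaking \<theta> \<omega> l'"
    using AE_unif
  proof eventually_elim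
    case (elim x)
    show ?case using Suc.IH[OF l(2)] elim by (auto elim!: eventually_mono)
  qed
  then have "AE x in unif. AE \<omega> in unif_seq.
      stick_breaking \<theta> (case_nat x \<omega>) (Suc i) \<noteq> stick_breaking \<theta> (case_nat x \<omega>) l"
    unfolding l stick_breaking_Suc .
  then show ?case
    by (rule AE_unif_seq_shiftI[rotated]) measurable
qed

lemma AE_inj_stick_breaking:
  assumes "\<theta> > 0"
  shows "AE \<omega> in unif_seq. inj (stick_breaking \<theta> \<omega>)"
proof -
  have "AE \<omega> in unif_seq. \<forall>i l. i < l \<longrightarrow> stick_breaking \<theta> \<omega> i \<noteq> stick_breaking \<theta> \<omega> l"
    unfolding AE_all_countable using AE_stick_breaking_neq[OF assms] by (auto intro: AE_I2)
  then show ?thesis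
    by (rule eventually_mono) (metis injI linorder_neqE_nat)
qed

lemma nn_integral_prod_unif_seq:
  assumes [measurable]: "f \<in> borel_measurable borel"
  shows "(\<integral>\<^sup>+\<omega>. (\<Prod>j<k. f (\<omega> j)) \<partial>unif_seq) = (\<integral>\<^sup>+x. f x \<partial>unif) ^ k"
proof (induction k)
  case 0
  show ?case using unif_seq.emeasure_space_1 by simp
next
  case (Suc k)
  have "(\<integral>\<^sup>+\<omega>. (\<Prod>j<Suc k. f (\<omega> j)) \<partial>unif_seq)
      = (\<integral>\<^sup>+x. \<integral>\<^sup>+\<omega>. (\<Prod>j<Suc k. f (case_nat x \<omega> j)) \<partial>unif_seq \<partial>unif)"
    by (rule nn_integral_unif_seq_shift) measurable
  also have "\<dots> = (\<integral>\<^sup>+x. \<integral>\<^sup>+\<omega>. f x * (\<Prod>j<k. f (\<omega> j)) \<partial>unif_seq \<partial>unif)"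
    by (subst prod.lessThan_Suc_shift) simp
  also have "\<dots> = (\<integral>\<^sup>+x. f x * (\<integral>\<^sup>+x. f x \<partial>unif) ^ k \<partial>unif)"
    by (subst nn_integral_cmult) (measurable, simp add: Suc.IH)
  also have "\<dots> = (\<integral>\<^sup>+x. f x \<partial>unif) ^ Suc k"
    by (subst nn_integral_multc) simp_all
  finally show ?case .
qed

text \<open>The length left after \<open>k\<close> breaks is a product of \<open>k\<close>
  independent factors with common mean c < 1, so its expectation is \<open>c ^ k\<close>. The
  expectations are summable, hence the lengths themselves are almost surely summable and tend to
  0.\<close>

lemma AE_sum_stick_breaking_tendsto:
  assumes "\<theta> > 0"
  shows "AE \<omega> in unif_seq. (\<lambda>k. \<Sum>i<k. stick_breaking \<theta> \<omega> i) \<longlonglongrightarrow> 1"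
proof -
  let ?W = "\<lambda>k \<omega>. \<Prod>j<k. \<omega> j powr (1 / \<theta>)"
  define c where "c = (\<integral>\<^sup>+x. ennreal (x powr (1 / \<theta>)) \<partial>unif)"
  have lt: "AE x in unif. x powr (1 / \<theta>) < 1"
    using AE_unif
  proof (rule eventually_mono)
    fix x :: real assume "0 < x \<and> x < 1"
    then show "x powr (1 / \<theta>) < 1" using powr_less_mono2[of "1 / \<theta>" x 1] assms by simp
  qed
  have le: "c \<le> (\<integral>\<^sup>+x. 1 \<partial>unif)"
    unfolding c_def using lt by (intro nn_integral_mono_AE) (auto elim!: eventually_mono)
  have "c < (\<integral>\<^sup>+x. 1 \<partial>unif)"
    unfolding c_def
  proof (rule nn_integral_less)
    show "(\<integral>\<^sup>+x. ennreal (x powr (1 / \<theta>)) \<partial>unif) \<noteq> \<infinity>"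
      using le unif_seq.M.emeasure_space_1 by (auto simp: c_def[symmetric] top_unique)
    show "AE x in unif. ennreal (x powr (1 / \<theta>)) \<le> 1"
      using lt by (auto elim!: eventually_mono)
    show "\<not> (AE x in unif. 1 \<le> ennreal (x powr (1 / \<theta>)))"
    proof
      assume "AE x in unif. 1 \<le> ennreal (x powr (1 / \<theta>))"
      with lt have "AE x in unif. False"
        by eventually_elim (simp add: not_le[symmetric])
      then show False by simp
    qed
  qed measurable
  then have "c < 1" using unif_seq.M.emeasure_space_1 by simp
  then obtain c' where c': "c = ennreal c'" "0 \<le> c'" "c' < 1"
    by (cases c) (auto simp: ennreal_less_one_iff)
  have "(\<integral>\<^sup>+\<omega>. (\<Sum>k. ennreal (?W k \<omega>)) \<partial>unif_seq) = (\<Sum>k. \<integral>\<^sup>+\<omega>. ennreal (?W k \<omega>) \<partial>unif_seq)"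
    by (rule nn_integral_suminf) measurable
  also have "\<dots> = (\<Sum>k. c ^ k)"
    unfolding c_def by (subst nn_integral_prod_unif_seq[symmetric])
      (measurable, simp add: prod_ennreal)
  also have "\<dots> = (\<Sum>k. ennreal (c' ^ k))"
    using c' by (simp add: ennreal_power)
  also have "\<dots> \<noteq> \<infinity>"
    using c' by (simp add: ennreal_suminf_neq_top summable_geometric)
  finally have "AE \<omega> in unif_seq. (\<Sum>k. ennreal (?W k \<omega>)) \<noteq> \<infinity>"
    by (intro nn_integral_noteq_infinite) measurable
  then show ?thesis
  proof (rule eventually_mono)
    fix \<omega> assume "(\<Sum>k. ennreal (?W k \<omega>)) \<noteq> \<infinity>"
    then have "summable (\<lambda>k. ?W k \<omega>)"
      by (intro summable_suminf_not_top) (auto intro: prod_nonneg)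
    then have "(\<lambda>k. ?W k \<omega>) \<longlonglongrightarrow> 0" by (rule summable_LIMSEQ_zero)
    then have "(\<lambda>k. 1 - ?W k \<omega>) \<longlonglongrightarrow> 1 - 0" by (intro tendsto_intros)
    then show "(\<lambda>k. \<Sum>i<k. stick_breaking \<theta> \<omega> i) \<longlonglongrightarrow> 1"
      by (simp add: sum_stick_breaking)
  qed
qed

section \<open>The multiset of stick-breaking lengths\<close>

lemma multisubset_seq_multiset: "multisubset (seq_multiset g)"
proof -
  have "{u. seq_multiset g u \<noteq> 0} \<subseteq> range g"
  proof
    fix u assume "u \<in> {u. seq_multiset g u \<noteq> 0}"
    then have "card {i. g i = u} \<noteq> 0" by (simp add: seq_multiset_def split: if_splits)
    then have "{i. g i = u} \<noteq> {}" by (metis card.empty)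
    then show "u \<in> range g" by auto
  qed
  then have "countable {u. seq_multiset g u \<noteq> 0}"
    by (rule countable_subset) simp
  moreover have "{u. seq_multiset g u \<noteq> 0} \<subseteq> {0<..1}"
    by (auto simp: seq_multiset_def split: if_splits)
  ultimately show ?thesis
    by (simp add: multisubset_def)
qed

lemma seq_multiset_inj:
  assumes "inj g" "g i \<in> {0<..1}"
  shows "seq_multiset g (g i) = 1"
proof -
  have "{j. g j = g i} = {i}" using assms(1) by (auto dest: injD)
  then show ?thesis using assms(2) by (simp add: seq_multiset_def)
qed

lemma msum_seq_multiset_le:
  assumes inj: "inj g" and range: "\<And>i. g i \<in> {0<..1}" and sum: "\<And>k. (\<Sum>i<k. g i) \<le> 1"
  shows "msum (seq_multiset g) \<le> 1"
proof -
  have zero: "seq_multiset g u = 0" if "u \<notin> range g" for u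
    using that by (auto simp: seq_multiset_def card_eq_0_iff)
  have "msum (seq_multiset g) = (\<integral>\<^sup>+u. ennreal u * of_nat (seq_multiset g u) \<partial>count_space (range g))"
    unfolding msum_def using zero range by (intro nn_integral_count_space_eq) auto
  also have "\<dots> = (\<integral>\<^sup>+i. ennreal (g i) * of_nat (seq_multiset g (g i)) \<partial>count_space UNIV)"
    using inj by (intro nn_integral_bij_count_space[symmetric]) (simp add: bij_betw_def)
  also have "\<dots> = (\<Sum>i. ennreal (g i))"
    by (simp add: nn_integral_count_space_nat seq_multiset_inj[OF inj range])
  also have "\<dots> \<le> 1"
  proof (rule suminf_le_const)
    fix k
    have "(\<Sum>i<k. ennreal (g i)) = ennreal (\<Sum>i<k. g i)"
      using range by (intro sum_ennreal) (auto intro: less_imp_le)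
    then show "(\<Sum>i<k. ennreal (g i)) \<le> 1"
      using sum[of k] by simp
  qed simp
  finally show ?thesis .
qed

text \<open>Rewrites the count as a countable sum over indices with countable quantifiers, which is
  visibly measurable in the sequence. The side condition says that the value occurs finitely often;
  otherwise \<open>card\<close> makes its multiplicity 0. Measurability is needed for all sequences,
  so almost sure injectivity cannot be used here.\<close>

lemma mcount_seq_multiset:
  assumes "S \<subseteq> {0<..1}"
  shows "mcount (seq_multiset g) S = (\<Sum>i. if g i \<in> S \<and> (\<exists>n. \<forall>j. g j = g i \<longrightarrow> j < n) then 1 else 0)"
proof -
  let ?fin = "\<lambda>u. \<exists>n. \<forall>j. g j = u \<longrightarrow> j < n"
  have fin: "finite {j. g j = u} \<longleftrightarrow> ?fin u" for u
    by (auto simp: finite_nat_set_iff_bounded)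
  have "mcount (seq_multiset g) S
      = (\<integral>\<^sup>+u. (\<Sum>i. if g i = u \<and> ?fin u then 1 else 0) \<partial>count_space S)"
    unfolding mcount_def
  proof (intro nn_integral_cong)
    fix u assume "u \<in> space (count_space S)"
    then have u: "u \<in> {0<..1}" using assms by auto
    show "of_nat (seq_multiset g u) = (\<Sum>i. if g i = u \<and> ?fin u then 1 else (0 :: ennreal))"
    proof (cases "?fin u")
      case True
      then have "finite {j. g j = u}" by (simp add: fin)
      then have "(\<Sum>i. if g i = u \<and> ?fin u then 1 else (0 :: ennreal)) = (\<Sum>i\<in>{j. g j = u}. 1)"
        using True by (subst suminf_finite[of "{j. g j = u}"]) auto
      then show ?thesis using u by (simp add: seq_multiset_def)
    next
      case False
      then have "infinite {j. g j = u}" by (simp add: fin)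
      moreover have "(\<Sum>i. if g i = u \<and> ?fin u then 1 else (0 :: ennreal)) = 0"
        by (simp only: False simp_thms if_False suminf_zero)
      ultimately show ?thesis using u by (simp only: seq_multiset_def if_True card.infinite of_nat_0 not_False_eq_True)
    qed
  qed
  also have "\<dots> = (\<Sum>i. \<integral>\<^sup>+u. (if g i = u \<and> ?fin u then 1 else 0) \<partial>count_space S)"
    by (rule nn_integral_suminf) simp
  also have "\<dots> = (\<Sum>i. if g i \<in> S \<and> ?fin (g i) then 1 else 0)"
  proof (intro suminf_cong)
    fix i
    show "(\<integral>\<^sup>+u. (if g i = u \<and> ?fin u then 1 else 0) \<partial>count_space S) = (if g i \<in> S \<and> ?fin (g i) then 1 else (0::ennreal))"
    proof (cases "g i \<in> S \<and> ?fin (g i)")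
      case True
      have "(\<integral>\<^sup>+u. (if g i = u \<and> ?fin u then 1 else 0) \<partial>count_space S) = (\<Sum>u\<in>{g i}. if g i = u \<and> ?fin u then 1 else (0 :: ennreal))"
        using True by (intro nn_integral_count_space') auto
      then show ?thesis using True by simp
    next
      case False
      have "(\<integral>\<^sup>+u. (if g i = u \<and> ?fin u then 1 else 0) \<partial>count_space S) = (\<integral>\<^sup>+u. 0 \<partial>count_space S :: ennreal)"
        using False by (intro nn_integral_cong) auto
      then show ?thesis using False by auto
    qed
  qed
  finally show ?thesis .
qed

lemma measurable_ranked_stick_breaking:
  "(\<lambda>u. ranked (seq_multiset (stick_breaking \<theta> u))) \<in> measurable unif_seq (\<Pi>\<^sub>M i\<in>UNIV. borel)"
proof (rule ranked_measurable)
  fix S :: "real set" assume [measurable]: "S \<in> sets borel" and S: "S \<subseteq> {0<..1}"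
  show "(\<lambda>u. mcount (seq_multiset (stick_breaking \<theta> u)) S) \<in> borel_measurable unif_seq"
    unfolding mcount_seq_multiset[OF S] by measurable
qed (rule multisubset_seq_multiset)

section \<open>Grid boxes and multi-intensities\<close>

text \<open>Half-open cells of mesh 1/N are pairwise disjoint, whereas closed ones would share end
  points. The cell with index 0 is later left out, since the hypothesis asks for positive left
  ends.\<close>

definition lo :: "nat \<Rightarrow> nat \<Rightarrow> real" where "lo N c = real c / real N"
definition hi :: "nat \<Rightarrow> nat \<Rightarrow> real" where "hi N c = (real c + 1) / real N"
definition cell :: "nat \<Rightarrow> nat \<Rightarrow> real set" where "cell N c = {lo N c<..hi N c}"

text \<open>The boxes to which the hypothesis can be applied: distinct cells give disjoint
  intervals, and the condition on the upper ends is the bound on the sum of the right ends.\<close>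

definition cell_tuples :: "nat \<Rightarrow> nat \<Rightarrow> (nat \<Rightarrow> nat) set" where
  "cell_tuples k N = {j \<in> distinct_tuples k {1..<N}. (\<Sum>i<k. hi N (j i)) < 1}"

lemma lo_pos: "c \<in> {1..<N} \<Longrightarrow> 0 < lo N c"
  by (simp add: lo_def)

lemma lo_less_hi: "c \<in> {1..<N} \<Longrightarrow> lo N c < hi N c"
  by (simp add: lo_def hi_def divide_strict_right_mono)

lemma hi_le_1: "c \<in> {1..<N} \<Longrightarrow> hi N c \<le> 1"
  by (simp add: hi_def)

lemma mem_cell_iff: "N > 0 \<Longrightarrow> u \<in> cell N c \<longleftrightarrow> \<lceil>u * real N\<rceil> = int c + 1"
  by (auto simp: cell_def lo_def hi_def ceiling_eq_iff pos_divide_less_eq pos_le_divide_eq)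

lemma disjoint_cells: "disjoint_family_on (cell N) {1..<N}"
proof (cases "N > 0")
  case True
  then show ?thesis by (auto simp: disjoint_family_on_def mem_cell_iff)
qed (simp add: disjoint_family_on_def)

lemma finite_cell_tuples: "finite (cell_tuples k N)"
  unfolding cell_tuples_def by (rule finite_subset[OF _ finite_distinct_tuples[of "{1..<N}" k]]) blast+

lemma cell_tuples_mem: "j \<in> cell_tuples k N \<Longrightarrow> i < k \<Longrightarrow> j i \<in> {1..<N}"
  unfolding cell_tuples_def distinct_tuples_def by (blast dest: PiE_mem)

lemma sum_lo_less_1:
  assumes "j \<in> cell_tuples k N"
  shows "(\<Sum>i<k. lo N (j i)) < 1"
proof -
  have "(\<Sum>i<k. lo N (j i)) \<le> (\<Sum>i<k. hi N (j i))"
    using less_imp_le[OF lo_less_hi[OF cell_tuples_mem[OF assms]]] by (intro sum_mono) simp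
  then show ?thesis using assms by (simp add: cell_tuples_def)
qed

definition intensity_bound :: "real \<Rightarrow> real \<Rightarrow> real \<Rightarrow> nat \<Rightarrow> (nat \<Rightarrow> real) \<Rightarrow> (nat \<Rightarrow> real) \<Rightarrow> real" where
  "intensity_bound \<theta> \<alpha> \<beta> k a b =
     \<theta> ^ k / ((1 - (\<Sum>i<k. a i)) powr \<alpha> * (1 - (\<Sum>i<k. b i)) powr \<beta>) * (\<Prod>i<k. (b i - a i) / b i)"

text \<open>Apply the hypothesis to the closed intervals [a + s, b], which lie in (a, b], and let
  \<open>s\<close> decrease to 0: the counts are monotone in the set and the bound is continuous in
  \<open>s\<close>. This is how neighbouring grid cells become admissible together.\<close>

lemma intensity_bound_half_open:
  fixes a b :: "nat \<Rightarrow> real" and A :: "nat \<Rightarrow> 'w \<Rightarrow> real \<Rightarrow> nat"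
  assumes hyp: "\<And>a b. admissible_intervals k a b \<Longrightarrow>
      ennreal (intensity_bound \<theta> \<alpha> \<beta> k a b)
        \<le> liminf (\<lambda>n. \<integral>\<^sup>+\<omega>. (\<Prod>i<k. mcount (A n \<omega>) {a i..b i}) \<partial>M n)"
    and ab: "\<And>i. i < k \<Longrightarrow> 0 < a i \<and> a i < b i \<and> b i \<le> 1"
    and disj: "disjoint_family_on (\<lambda>i. {a i<..b i}) {..<k}"
    and sum: "(\<Sum>i<k. b i) < 1"
  shows "ennreal (intensity_bound \<theta> \<alpha> \<beta> k a b)
    \<le> liminf (\<lambda>n. \<integral>\<^sup>+\<omega>. (\<Prod>i<k. mcount (A n \<omega>) {a i<..b i}) \<partial>M n)" (is "_ \<le> ?L")
proof (rule tendsto_upperbound)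
  have "(\<Sum>i<k. a i) \<le> (\<Sum>i<k. b i)"
    using ab by (intro sum_mono) (auto intro: less_imp_le)
  then have ne: "1 - (\<Sum>i<k. a i + 0) \<noteq> 0" "1 - (\<Sum>i<k. b i) \<noteq> 0"
    using sum by auto
  have b: "b i \<noteq> 0" if "i < k" for i using ab[OF that] by auto
  have "((\<lambda>s. intensity_bound \<theta> \<alpha> \<beta> k (\<lambda>i. a i + s) b)
      \<longlongrightarrow> \<theta> ^ k / ((1 - (\<Sum>i<k. a i + 0)) powr \<alpha> * (1 - (\<Sum>i<k. b i)) powr \<beta>)
        * (\<Prod>i<k. (b i - (a i + 0)) / b i)) (at_right 0)"
    unfolding intensity_bound_def using ne b by (intro tendsto_intros) auto
  then have "((\<lambda>s. intensity_bound \<theta> \<alpha> \<beta> k (\<lambda>i. a i + s) b)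
      \<longlongrightarrow> intensity_bound \<theta> \<alpha> \<beta> k a b) (at_right 0)"
    by (simp add: intensity_bound_def)
  then show "((\<lambda>s. ennreal (intensity_bound \<theta> \<alpha> \<beta> k (\<lambda>i. a i + s) b))
      \<longlongrightarrow> ennreal (intensity_bound \<theta> \<alpha> \<beta> k a b)) (at_right 0)"
    by (rule tendsto_ennrealI)
  have "\<forall>\<^sub>F s in at_right 0. \<forall>i\<in>{..<k}. s < b i - a i"
  proof (intro eventually_ball_finite ballI)
    fix i assume "i \<in> {..<k}"
    then show "\<forall>\<^sub>F s in at_right 0. s < b i - a i"
      using ab[of i] eventually_at_right_real[of 0 "b i - a i"] by (auto elim: eventually_mono)
  qed simp
  moreover have "\<forall>\<^sub>F s::real in at_right 0. 0 < s"
    by (simp add: eventually_at_right_less)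
  ultimately show "\<forall>\<^sub>F s in at_right 0. ennreal (intensity_bound \<theta> \<alpha> \<beta> k (\<lambda>i. a i + s) b) \<le> ?L"
  proof eventually_elim
    case (elim s)
    have sub: "{a i + s..b i} \<subseteq> {a i<..b i}" for i using elim by auto
    have "disjoint_family_on (\<lambda>i. {a i + s..b i}) {..<k}"
      using disj sub unfolding disjoint_family_on_def by blast
    then have adm: "admissible_intervals k (\<lambda>i. a i + s) b"
      unfolding admissible_intervals_def using ab elim sum by (force intro: less_imp_le)
    have "ennreal (intensity_bound \<theta> \<alpha> \<beta> k (\<lambda>i. a i + s) b)
        \<le> liminf (\<lambda>n. \<integral>\<^sup>+\<omega>. (\<Prod>i<k. mcount (A n \<omega>) {a i + s..b i}) \<partial>M n)"
      by (rule hyp[OF adm])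
    also have "\<dots> \<le> ?L"
      by (intro Liminf_mono always_eventually allI nn_integral_mono prod_mono_ennreal mcount_mono sub)
    finally show ?case .
  qed
qed simp

text \<open>Every element is rounded down to the lower end of its cell, and the cells are
  disjoint.\<close>

lemma sum_lo_mcount_le:
  "(\<Sum>c\<in>{1..<N}. ennreal (lo N c) * mcount m (cell N c)) \<le> msum m"
proof -
  define \<nu> where "\<nu> = density (count_space UNIV) (\<lambda>u. ennreal u * of_nat (m u))"
  have \<nu>: "emeasure \<nu> S = (\<integral>\<^sup>+u. ennreal u * of_nat (m u) \<partial>count_space S)" for S
    unfolding \<nu>_def by (subst emeasure_density) (auto simp: nn_integral_count_space_indicator)
  have "(\<Sum>c\<in>{1..<N}. ennreal (lo N c) * mcount m (cell N c)) \<le> (\<Sum>c\<in>{1..<N}. emeasure \<nu> (cell N c))"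
  proof (rule sum_mono)
    fix c assume c: "c \<in> {1..<N}"
    have "ennreal (lo N c) * mcount m (cell N c)
        = (\<integral>\<^sup>+u. ennreal (lo N c) * of_nat (m u) \<partial>count_space (cell N c))"
      unfolding mcount_def by (simp add: nn_integral_cmult)
    also have "\<dots> \<le> emeasure \<nu> (cell N c)"
      unfolding \<nu> by (intro nn_integral_mono mult_right_mono) (auto intro: ennreal_leI simp: cell_def)
    finally show "ennreal (lo N c) * mcount m (cell N c) \<le> emeasure \<nu> (cell N c)" .
  qed
  also have "\<dots> = emeasure \<nu> (\<Union>c\<in>{1..<N}. cell N c)"
    by (intro sum_emeasure disjoint_cells) (auto simp: \<nu>_def)
  also have "\<dots> \<le> emeasure \<nu> {0<..1}"
  proof (rule emeasure_mono)
    show "(\<Union>c\<in>{1..<N}. cell N c) \<subseteq> {0<..1}"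
    proof
      fix u assume "u \<in> (\<Union>c\<in>{1..<N}. cell N c)"
      then obtain c where "c \<in> {1..<N}" "u \<in> cell N c" by blast
      then show "u \<in> {0<..1}"
        using lo_pos[of c N] hi_le_1[of c N] by (auto simp: cell_def)
    qed
  qed (simp add: \<nu>_def)
  also have "\<dots> = msum m" by (simp add: \<nu> msum_def)
  finally show ?thesis .
qed

section \<open>Selection weights on boxes and the lower bound for expectations\<close>

lemma pick_weight_nonneg:
  assumes "\<And>i. i < k \<Longrightarrow> 0 \<le> a i" "(\<Sum>i<k. a i) \<le> 1"
  shows "0 \<le> pick_weight k a"
  unfolding pick_weight_def
proof (intro prod_nonneg divide_nonneg_nonneg ballI)
  fix i assume i: "i \<in> {..<k}"
  show "0 \<le> a i" using assms(1) i by simp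
  have "(\<Sum>l<i. a l) \<le> (\<Sum>l<k. a l)"
    using i assms(1) by (intro sum_mono2) auto
  then show "0 \<le> 1 - (\<Sum>l<i. a l)" using assms(2) by linarith
qed

lemma pick_weight_lo_nonneg:
  assumes "j \<in> distinct_tuples k {1..<N}" "(\<Sum>i<k. lo N (j i)) < 1"
  shows "0 \<le> pick_weight k (lo N \<circ> j)"
  using assms by (intro pick_weight_nonneg) (auto simp: lo_def)

text \<open>Select \<open>k\<close> elements of \<open>m\<close> one after the other, each with probability equal to its size
  relative to the mass that is left.  The left-hand side bounds from below the probability that the
  selection falls into one of the boxes \<open>j\<close>.\<close>

lemma sum_pick_weight_mcount_le_1:
  assumes m: "msum m \<le> 1"
  shows "(\<Sum>j\<in>cell_tuples k N. ennreal (pick_weight k (lo N \<circ> j)) * (\<Prod>i<k. mcount m (cell N (j i)))) \<le> 1"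
proof -
  let ?C = "{1..<N}"
  let ?J = "{j. j \<in> distinct_tuples k ?C \<and> (\<Sum>i<k. lo N (j i)) < 1}"
  define n where "n c = enn2real (mcount m (cell N c))" for c
  have lf: "locally_finite m"
    using m by (intro locally_finite_if_msum_finite) (auto simp: order_le_less_trans)
  have n: "mcount m (cell N c) = ennreal (n c)" if c: "c \<in> ?C" for c
  proof -
    have "mcount m (cell N c) \<le> mcount m {lo N c..1}"
      using hi_le_1[OF c] by (intro mcount_mono) (auto simp: cell_def)
    also have "\<dots> < \<infinity>" using lf lo_pos[OF c] by (simp add: locally_finite_def)
    finally show ?thesis by (simp add: n_def less_top)
  qed
  have n0: "n c \<ge> 0" for c by (simp add: n_def)
  have "(\<Sum>j\<in>cell_tuples k N. ennreal (pick_weight k (lo N \<circ> j)) * (\<Prod>i<k. mcount m (cell N (j i))))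
      = (\<Sum>j\<in>cell_tuples k N. ennreal (pick_weight k (lo N \<circ> j) * (\<Prod>i<k. n (j i))))"
  proof (rule sum.cong[OF refl])
    fix j assume j: "j \<in> cell_tuples k N"
    have w: "0 \<le> pick_weight k (lo N \<circ> j)"
      using j sum_lo_less_1[OF j] by (intro pick_weight_lo_nonneg) (auto simp: cell_tuples_def)
    have "(\<Prod>i<k. mcount m (cell N (j i))) = (\<Prod>i<k. ennreal (n (j i)))"
      using n[OF cell_tuples_mem[OF j]] by (intro prod.cong) auto
    also have "\<dots> = ennreal (\<Prod>i<k. n (j i))"
      using n0 by (intro prod_ennreal) auto
    finally show "ennreal (pick_weight k (lo N \<circ> j)) * (\<Prod>i<k. mcount m (cell N (j i)))
        = ennreal (pick_weight k (lo N \<circ> j) * (\<Prod>i<k. n (j i)))"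
      using w n0 by (simp add: ennreal_mult prod_nonneg)
  qed
  \<comment> \<open>\<open>sum_pick_weight_le_1\<close> knows the lower ends only, so the tuples are
    enlarged to those whose lower ends have sum below 1.\<close>
  also have "\<dots> \<le> (\<Sum>j\<in>?J. ennreal (pick_weight k (lo N \<circ> j) * (\<Prod>i<k. n (j i))))"
    using sum_lo_less_1 finite_distinct_tuples[of ?C k]
    by (intro sum_mono2) (auto simp: cell_tuples_def)
  also have "\<dots> = ennreal (\<Sum>j\<in>?J. pick_weight k (lo N \<circ> j) * (\<Prod>i<k. n (j i)))"
    using pick_weight_lo_nonneg n0 by (intro sum_ennreal) (auto intro!: mult_nonneg_nonneg prod_nonneg)
  also have "\<dots> \<le> ennreal 1"
  proof (intro ennreal_leI sum_pick_weight_le_1)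
    fix c assume c: "c \<in> ?C"
    show "0 < lo N c" using lo_pos[OF c] .
    show "n c = 0 \<or> 1 \<le> n c"
      using mcount_ge_1[of m "cell N c"] n[OF c] n0[of c] by (auto simp: ennreal_eq_0_iff)
  next
    have "ennreal (\<Sum>c\<in>?C. lo N c * n c) = (\<Sum>c\<in>?C. ennreal (lo N c * n c))"
      using n0 by (intro sum_ennreal[symmetric]) (auto simp: lo_def)
    also have "\<dots> = (\<Sum>c\<in>?C. ennreal (lo N c) * mcount m (cell N c))"
      by (intro sum.cong refl) (simp add: n n0 ennreal_mult[symmetric] lo_def del: times_divide_eq_left)
    also have "\<dots> \<le> ennreal 1"
      using sum_lo_mcount_le[of N m] m by simp
    finally show "(\<Sum>c\<in>?C. lo N c * n c) \<le> 1"
      by (subst (asm) ennreal_le_iff) simp_all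
  qed simp
  finally show ?thesis by simp
qed

text \<open>All that a box reveals about a multiset. The infimum of \<open>F\<close> over this set
  is a constant lower bound for \<open>F\<close> at any multiset that meets the cells of the
  box.\<close>

definition occupied :: "nat \<Rightarrow> nat \<Rightarrow> (nat \<Rightarrow> nat) \<Rightarrow> (real \<Rightarrow> nat) set" where
  "occupied k N j = {m. multisubset m \<and> msum m \<le> 1 \<and> (\<forall>i<k. \<exists>x\<in>cell N (j i). m x \<noteq> 0)}"

text \<open>A box has nonzero weight only if \<open>m\<close> itself is \<open>occupied\<close>, so
  each infimum that counts is at most \<open>F m\<close>; and the weights add up to at most
  1.\<close>

lemma sum_INF_occupied_le:
  fixes F :: "(real \<Rightarrow> nat) \<Rightarrow> ennreal"
  assumes m: "multisubset m" "msum m \<le> 1"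
  shows "(\<Sum>j\<in>cell_tuples k N. (INF m'\<in>occupied k N j. F m') *
      (ennreal (pick_weight k (lo N \<circ> j)) * (\<Prod>i<k. mcount m (cell N (j i))))) \<le> F m"
proof -
  let ?w = "\<lambda>j. ennreal (pick_weight k (lo N \<circ> j)) * (\<Prod>i<k. mcount m (cell N (j i)))"
  have "(\<Sum>j\<in>cell_tuples k N. (INF m'\<in>occupied k N j. F m') * ?w j) \<le> (\<Sum>j\<in>cell_tuples k N. F m * ?w j)"
  proof (rule sum_mono)
    fix j
    show "(INF m'\<in>occupied k N j. F m') * ?w j \<le> F m * ?w j"
    proof (cases "\<exists>i<k. mcount m (cell N (j i)) = 0")
      case True
      then have "(\<Prod>i<k. mcount m (cell N (j i))) = 0" by (auto intro: prod_zero)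
      then have "?w j = 0" by (simp only: mult_zero_right)
      then show ?thesis by (simp only: mult_zero_right order_refl)
    next
      case False
      then have "m \<in> occupied k N j"
        using m by (auto simp: occupied_def mcount_eq_0_iff)
      then show ?thesis by (intro mult_right_mono INF_lower) auto
    qed
  qed
  also have "\<dots> = F m * (\<Sum>j\<in>cell_tuples k N. ?w j)"
    by (simp add: sum_distrib_left)
  also have "\<dots> \<le> F m * 1"
    using sum_pick_weight_mcount_le_1[OF m(2)] by (intro mult_left_mono) auto
  finally show ?thesis by simp
qed

text \<open>Fatou's lemma for the finite point measure with weights \<open>c\<close>.\<close>

lemma sum_liminf_le:
  fixes c :: "'a \<Rightarrow> ennreal"
  assumes "finite J"
  shows "(\<Sum>j\<in>J. c j * liminf (\<lambda>n. u n j)) \<le> liminf (\<lambda>n. \<Sum>j\<in>J. c j * u n j)"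
proof -
  have "(\<integral>\<^sup>+j. liminf (\<lambda>n. u n j) \<partial>point_measure J c) \<le> liminf (\<lambda>n. \<integral>\<^sup>+j. u n j \<partial>point_measure J c)"
    by (rule nn_integral_liminf) simp
  then show ?thesis
    by (simp only: nn_integral_point_measure_finite[OF assms])
qed

text \<open>Integrate \<open>sum_INF_occupied_le\<close> along \<open>A n\<close>. There are
  finitely many boxes with constant coefficients, so the lower limit may be taken in each box
  separately, where the hypothesis bounds it.\<close>

lemma liminf_nn_integral_ge:
  fixes F :: "(real \<Rightarrow> nat) \<Rightarrow> ennreal" and A :: "nat \<Rightarrow> 'w \<Rightarrow> real \<Rightarrow> nat"
  assumes A: "\<And>n. random_multisubset (M n) (A n)"
    and msum: "\<And>n. AE \<omega> in M n. msum (A n \<omega>) \<le> 1"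
    and hyp: "\<And>a b. admissible_intervals k a b \<Longrightarrow>
      ennreal (intensity_bound \<theta> \<alpha> \<beta> k a b)
        \<le> liminf (\<lambda>n. \<integral>\<^sup>+\<omega>. (\<Prod>i<k. mcount (A n \<omega>) {a i..b i}) \<partial>M n)"
  shows "(\<Sum>j\<in>cell_tuples k N. (INF m\<in>occupied k N j. F m) *
      (ennreal (pick_weight k (lo N \<circ> j)) * ennreal (intensity_bound \<theta> \<alpha> \<beta> k (lo N \<circ> j) (hi N \<circ> j))))
    \<le> liminf (\<lambda>n. \<integral>\<^sup>+\<omega>. F (A n \<omega>) \<partial>M n)"
proof -
  let ?J = "cell_tuples k N"
  define c where "c j = (INF m\<in>occupied k N j. F m) * ennreal (pick_weight k (lo N \<circ> j))" for j
  let ?u = "\<lambda>n j. \<integral>\<^sup>+\<omega>. (\<Prod>i<k. mcount (A n \<omega>) (cell N (j i))) \<partial>M n"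
  have "(\<Sum>j\<in>?J. (INF m\<in>occupied k N j. F m) *
      (ennreal (pick_weight k (lo N \<circ> j)) * ennreal (intensity_bound \<theta> \<alpha> \<beta> k (lo N \<circ> j) (hi N \<circ> j))))
    = (\<Sum>j\<in>?J. c j * ennreal (intensity_bound \<theta> \<alpha> \<beta> k (lo N \<circ> j) (hi N \<circ> j)))"
    by (simp add: c_def mult.assoc)
  also have "\<dots> \<le> (\<Sum>j\<in>?J. c j * liminf (\<lambda>n. ?u n j))"
  proof (intro sum_mono mult_left_mono)
    fix j assume j: "j \<in> ?J"
    have "disjoint_family_on (\<lambda>i. {(lo N \<circ> j) i<..(hi N \<circ> j) i}) {..<k}"
      unfolding disjoint_family_on_def
    proof safe
      fix i l x assume *: "i < k" "l < k" "i \<noteq> l"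
        "x \<in> {(lo N \<circ> j) i<..(hi N \<circ> j) i}" "x \<in> {(lo N \<circ> j) l<..(hi N \<circ> j) l}"
      have "inj_on j {..<k}" using j by (simp add: cell_tuples_def distinct_tuples_def)
      then have "j i \<noteq> j l" using * by (auto dest: inj_onD)
      then have "cell N (j i) \<inter> cell N (j l) = {}"
        using disjoint_cells[of N] cell_tuples_mem[OF j] *(1,2) by (auto simp: disjoint_family_on_def)
      then show "x \<in> {}" using *(4,5) by (auto simp: cell_def)
    qed
    moreover have "0 < (lo N \<circ> j) i \<and> (lo N \<circ> j) i < (hi N \<circ> j) i \<and> (hi N \<circ> j) i \<le> 1" if "i < k" for i
      using lo_pos lo_less_hi hi_le_1 cell_tuples_mem[OF j that] by (auto simp del: atLeastLessThan_iff)
    ultimately have "ennreal (intensity_bound \<theta> \<alpha> \<beta> k (lo N \<circ> j) (hi N \<circ> j)) \<le>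
      liminf (\<lambda>n. \<integral>\<^sup>+\<omega>. (\<Prod>i<k. mcount (A n \<omega>) {(lo N \<circ> j) i<..(hi N \<circ> j) i}) \<partial>M n)"
      using j by (intro intensity_bound_half_open hyp) (auto simp: cell_tuples_def)
    then show "ennreal (intensity_bound \<theta> \<alpha> \<beta> k (lo N \<circ> j) (hi N \<circ> j)) \<le> liminf (\<lambda>n. ?u n j)"
      by (simp add: cell_def)
  qed simp
  also have "\<dots> \<le> liminf (\<lambda>n. \<Sum>j\<in>?J. c j * ?u n j)"
    by (rule sum_liminf_le[OF finite_cell_tuples])
  also have "\<dots> \<le> liminf (\<lambda>n. \<integral>\<^sup>+\<omega>. F (A n \<omega>) \<partial>M n)"
  proof (intro Liminf_mono always_eventually allI)
    fix n
    have meas: "(\<lambda>\<omega>. \<Prod>i<k. mcount (A n \<omega>) (cell N (j i))) \<in> borel_measurable (M n)" if j: "j \<in> ?J" for j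
    proof (rule borel_measurable_prod_ennreal)
      fix i assume "i \<in> {..<k}"
      then have c: "j i \<in> {1..<N}" using cell_tuples_mem[OF j] by simp
      have "cell N (j i) \<subseteq> {0<..1}"
        using lo_pos[OF c] hi_le_1[OF c] by (auto simp: cell_def)
      moreover have "cell N (j i) \<in> sets borel" by (simp add: cell_def)
      ultimately show "(\<lambda>\<omega>. mcount (A n \<omega>) (cell N (j i))) \<in> borel_measurable (M n)"
        using A[of n] by (auto simp: random_multisubset_def)
    qed
    have "(\<Sum>j\<in>?J. c j * ?u n j) = (\<Sum>j\<in>?J. \<integral>\<^sup>+\<omega>. c j * (\<Prod>i<k. mcount (A n \<omega>) (cell N (j i))) \<partial>M n)"
      using meas by (intro sum.cong refl nn_integral_cmult[symmetric])
    also have "\<dots> = (\<integral>\<^sup>+\<omega>. (\<Sum>j\<in>?J. c j * (\<Prod>i<k. mcount (A n \<omega>) (cell N (j i)))) \<partial>M n)"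
      using meas by (intro nn_integral_sum[symmetric] borel_measurable_times) auto
    also have "\<dots> \<le> (\<integral>\<^sup>+\<omega>. F (A n \<omega>) \<partial>M n)"
    proof (rule nn_integral_mono_AE)
      show "AE \<omega> in M n. (\<Sum>j\<in>?J. c j * (\<Prod>i<k. mcount (A n \<omega>) (cell N (j i)))) \<le> F (A n \<omega>)"
        using msum[of n] AE_space
      proof eventually_elim
        case (elim \<omega>)
        then have "multisubset (A n \<omega>)" using A[of n] by (simp add: random_multisubset_def)
        from sum_INF_occupied_le[OF this elim(1), of F k N] show ?case
          by (simp add: c_def mult.assoc)
      qed
    qed
    finally show "(\<Sum>j\<in>?J. c j * ?u n j) \<le> (\<integral>\<^sup>+\<omega>. F (A n \<omega>) \<partial>M n)" .
  qed
  finally show ?thesis .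
qed

section \<open>Comparison with the stick-breaking law\<close>

text \<open>The lower bound for the size-biased selection to fall into a box, divided by the upper bound of
  \<open>stick_breaking_box_le\<close> for the same box.\<close>

definition box_ratio :: "real \<Rightarrow> real \<Rightarrow> real \<Rightarrow> nat \<Rightarrow> (nat \<Rightarrow> real) \<Rightarrow> (nat \<Rightarrow> real) \<Rightarrow> real" where
  "box_ratio \<theta> \<alpha> \<beta> k a b =
     1 / ((1 - (\<Sum>i<k. a i)) powr \<alpha> * (1 - (\<Sum>i<k. b i)) powr \<beta> *
          max ((1 - (\<Sum>i<k. a i)) powr (\<theta> - 1)) ((1 - (\<Sum>i<k. b i)) powr (\<theta> - 1))) *
     (\<Prod>i<k. a i / b i * ((1 - (\<Sum>l<i. b l)) / (1 - (\<Sum>l<i. a l))))"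

lemma partial_sum_less_1:
  fixes b :: "nat \<Rightarrow> real"
  assumes "\<And>i. i < k \<Longrightarrow> 0 \<le> b i" "(\<Sum>i<k. b i) < 1" "i \<le> k"
  shows "(\<Sum>l<i. b l) < 1"
proof -
  have "(\<Sum>l<i. b l) \<le> (\<Sum>l<k. b l)"
    using assms(1,3) by (intro sum_mono2) auto
  then show ?thesis using assms(2) by linarith
qed

lemma box_ratio_nonneg:
  assumes "\<And>i. i < k \<Longrightarrow> 0 \<le> a i \<and> a i \<le> b i" "(\<Sum>i<k. b i) < 1"
  shows "0 \<le> box_ratio \<theta> \<alpha> \<beta> k a b"
proof -
  have a: "(\<Sum>i<k. a i) < 1"
    using sum_mono[of "{..<k}" a b] assms by fastforce
  have "0 \<le> a i / b i * ((1 - (\<Sum>l<i. b l)) / (1 - (\<Sum>l<i. a l)))" if i: "i < k" for i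
  proof (intro mult_nonneg_nonneg divide_nonneg_nonneg)
    show "0 \<le> a i" "0 \<le> b i" using assms(1)[OF i] by auto
    show "0 \<le> 1 - (\<Sum>l<i. b l)"
      using partial_sum_less_1[of k b i] assms i by fastforce
    show "0 \<le> 1 - (\<Sum>l<i. a l)"
      using partial_sum_less_1[of k a i] assms(1) a i by fastforce
  qed
  then have "0 \<le> (\<Prod>i<k. a i / b i * ((1 - (\<Sum>l<i. b l)) / (1 - (\<Sum>l<i. a l))))"
    by (intro prod_nonneg) simp
  then show ?thesis
    unfolding box_ratio_def
    by (intro mult_nonneg_nonneg divide_nonneg_nonneg) (simp_all add: le_max_iff_disj)
qed

text \<open>The power is increasing or decreasing according to the sign of \<open>p\<close>. It is
  used with exponent \<theta> - 1, whose sign is not fixed.\<close>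

lemma powr_le_max:
  fixes s t u p :: real
  assumes "0 < s" "s \<le> t" "t \<le> u"
  shows "t powr p \<le> max (u powr p) (s powr p)"
proof (cases "p \<ge> 0")
  case True
  then have "t powr p \<le> u powr p" using assms by (intro powr_mono2) auto
  then show ?thesis by simp
next
  case False
  then have "t powr p \<le> s powr p" using assms by (intro powr_mono2') auto
  then show ?thesis by simp
qed

text \<open>With \<open>U\<close> the upper bound for the probability of the box,
  \<open>box_ratio * U\<close> equals \<open>pick_weight * intensity_bound\<close> exactly: the
  factor \<open>max\<close> in the ratio cancels the bound \<open>Z\<close> on the density, and the
  side lengths \<open>b i - a i\<close> occur on both sides.\<close>

lemma box_ratio_mult_le:
  fixes a b :: "nat \<Rightarrow> real"
  assumes \<theta>: "\<theta> > 0" and ab: "\<And>i. i < k \<Longrightarrow> 0 < a i \<and> a i < b i" and sum: "(\<Sum>i<k. b i) < 1"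
  shows "ennreal (box_ratio \<theta> \<alpha> \<beta> k a b) *
      (\<integral>\<^sup>+\<omega>. indicator {\<omega>. \<forall>i<k. stick_breaking \<theta> \<omega> i \<in> {a i<..b i}} \<omega> \<partial>unif_seq)
    \<le> ennreal (pick_weight k a) * ennreal (intensity_bound \<theta> \<alpha> \<beta> k a b)"
proof -
  let ?sa = "1 - (\<Sum>i<k. a i)" and ?sb = "1 - (\<Sum>i<k. b i)"
  let ?Z = "max (?sa powr (\<theta> - 1)) (?sb powr (\<theta> - 1))"
  have ab': "0 \<le> a i \<and> a i \<le> b i" "0 \<le> b i" if "i < k" for i using ab[OF that] by auto
  have le: "(\<Sum>i<k. a i) \<le> (\<Sum>i<k. b i)"
    using ab' by (intro sum_mono) auto
  have pa: "(\<Sum>l<i. a l) < 1" and pb: "(\<Sum>l<i. b l) < 1" if "i \<le> k" for i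
    using partial_sum_less_1[of k a i] partial_sum_less_1[of k b i] ab' le sum that by auto
  have Z: "?Z > 0" using sum by (simp add: less_max_iff_disj)
  define U where "U = \<theta> ^ k * 1 powr (1 - \<theta>) * ?Z * (\<Prod>i<k. (b i - a i) / (1 - (\<Sum>j<i. b j)))"
  have "(\<integral>\<^sup>+\<omega>. indicator {\<omega>. \<forall>i<k. stick_breaking \<theta> \<omega> i \<in> {a i<..b i}} \<omega> \<partial>unif_seq)
    \<le> (\<integral>\<^sup>+\<omega>. indicator {\<omega>. \<forall>i<k. 1 * stick_breaking \<theta> \<omega> i \<in> {a i..b i}} \<omega> \<partial>unif_seq)"
    by (intro nn_integral_mono) (auto simp: indicator_def less_imp_le)
  also have "\<dots> \<le> ennreal U"
    unfolding U_def
  proof (rule stick_breaking_box_le[OF \<theta>])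
    fix t assume "1 - (\<Sum>i<k. b i) \<le> t" "t \<le> 1 - (\<Sum>i<k. a i)"
    then show "t powr (\<theta> - 1) \<le> ?Z" using sum by (intro powr_le_max) auto
  qed (use ab' sum in auto)
  finally have U: "(\<integral>\<^sup>+\<omega>. indicator {\<omega>. \<forall>i<k. stick_breaking \<theta> \<omega> i \<in> {a i<..b i}} \<omega> \<partial>unif_seq) \<le> ennreal U" .
  have fac: "a i / b i * ((1 - (\<Sum>l<i. b l)) / (1 - (\<Sum>l<i. a l))) * ((b i - a i) / (1 - (\<Sum>j<i. b j)))
      = a i / (1 - (\<Sum>l<i. a l)) * ((b i - a i) / b i)" if "i < k" for i
    using pb[of i] that by simp
  have "box_ratio \<theta> \<alpha> \<beta> k a b * U =
      \<theta> ^ k / (?sa powr \<alpha> * ?sb powr \<beta>) *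
      (\<Prod>i<k. a i / b i * ((1 - (\<Sum>l<i. b l)) / (1 - (\<Sum>l<i. a l))) * ((b i - a i) / (1 - (\<Sum>j<i. b j))))"
    unfolding box_ratio_def U_def prod.distrib using Z by simp
  also have "\<dots> = \<theta> ^ k / (?sa powr \<alpha> * ?sb powr \<beta>) *
      (\<Prod>i<k. a i / (1 - (\<Sum>l<i. a l)) * ((b i - a i) / b i))"
    by (intro arg_cong[of _ _ "\<lambda>p. \<theta> ^ k / (?sa powr \<alpha> * ?sb powr \<beta>) * p"] prod.cong refl fac) simp
  also have "\<dots> = pick_weight k a * intensity_bound \<theta> \<alpha> \<beta> k a b"
    unfolding pick_weight_def intensity_bound_def prod.distrib by simp
  finally have eq: "box_ratio \<theta> \<alpha> \<beta> k a b * U = pick_weight k a * intensity_bound \<theta> \<alpha> \<beta> k a b" .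
  have ratio: "0 \<le> box_ratio \<theta> \<alpha> \<beta> k a b"
    using ab' sum by (intro box_ratio_nonneg) auto
  have "ennreal (box_ratio \<theta> \<alpha> \<beta> k a b) *
      (\<integral>\<^sup>+\<omega>. indicator {\<omega>. \<forall>i<k. stick_breaking \<theta> \<omega> i \<in> {a i<..b i}} \<omega> \<partial>unif_seq)
      \<le> ennreal (box_ratio \<theta> \<alpha> \<beta> k a b) * ennreal U"
    by (intro mult_left_mono U) simp
  also have "\<dots> = ennreal (pick_weight k a * intensity_bound \<theta> \<alpha> \<beta> k a b)"
    using ratio by (simp only: ennreal_mult'[symmetric] eq)
  also have "\<dots> = ennreal (pick_weight k a) * ennreal (intensity_bound \<theta> \<alpha> \<beta> k a b)"
    using ab' le sum by (intro ennreal_mult' pick_weight_nonneg) auto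
  finally show ?thesis .
qed

text \<open>When the box shrinks to a point \<open>x\<close>, the three powers of 1 - \<Sum>x have
  exponents \<alpha>, \<beta> and \<theta> - 1, which add up to 0; all other factors are quotients
  of terms with equal nonzero limits.\<close>

lemma tendsto_box_ratio:
  fixes a b :: "nat \<Rightarrow> nat \<Rightarrow> real"
  assumes ab: "\<alpha> + \<beta> = 1 - \<theta>"
    and a: "\<And>i. i < k \<Longrightarrow> (\<lambda>N. a N i) \<longlonglongrightarrow> x i" and b: "\<And>i. i < k \<Longrightarrow> (\<lambda>N. b N i) \<longlonglongrightarrow> x i"
    and x: "\<And>i. i < k \<Longrightarrow> 0 < x i" "(\<Sum>i<k. x i) < 1"
  shows "(\<lambda>N. box_ratio \<theta> \<alpha> \<beta> k (a N) (b N)) \<longlonglongrightarrow> 1"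
proof -
  let ?s = "1 - (\<Sum>i<k. x i)"
  have s: "?s > 0" using x(2) by simp
  have px: "1 - (\<Sum>l<i. x l) \<noteq> 0" if "i < k" for i
    using partial_sum_less_1[of k x i] less_imp_le[OF x(1)] x(2) that by fastforce
  have xne: "x i \<noteq> 0" if "i < k" for i using x(1)[OF that] by simp
  have "(\<lambda>N. box_ratio \<theta> \<alpha> \<beta> k (a N) (b N)) \<longlonglongrightarrow>
    1 / (?s powr \<alpha> * ?s powr \<beta> * max (?s powr (\<theta> - 1)) (?s powr (\<theta> - 1))) *
     (\<Prod>i<k. x i / x i * ((1 - (\<Sum>l<i. x l)) / (1 - (\<Sum>l<i. x l))))"
    unfolding box_ratio_def using a b s px xne
    by (intro tendsto_intros) auto
  also have "?s powr \<alpha> * ?s powr \<beta> * max (?s powr (\<theta> - 1)) (?s powr (\<theta> - 1)) = ?s powr (\<alpha> + \<beta> + (\<theta> - 1))"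
    by (simp only: powr_add max.idem)
  also have "\<alpha> + \<beta> + (\<theta> - 1) = 0" using ab by simp
  also have "1 / ?s powr 0 * (\<Prod>i<k. x i / x i * ((1 - (\<Sum>l<i. x l)) / (1 - (\<Sum>l<i. x l)))) = 1"
    using s px xne by simp
  finally show ?thesis .
qed

text \<open>Box by box this is \<open>box_ratio_mult_le\<close>. With \<open>c\<close> the infimum
  over \<open>occupied\<close>, the right-hand side is the left-hand side of
  \<open>liminf_nn_integral_ge\<close>, so the two estimates chain.\<close>

lemma nn_integral_lower_step_le:
  fixes c :: "(nat \<Rightarrow> nat) \<Rightarrow> ennreal"
  assumes \<theta>: "\<theta> > 0"
  shows "(\<integral>\<^sup>+\<omega>. (\<Sum>j\<in>cell_tuples k N. c j * (ennreal (box_ratio \<theta> \<alpha> \<beta> k (lo N \<circ> j) (hi N \<circ> j)) *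
        indicator {x. \<forall>i<k. x i \<in> cell N (j i)} (stick_breaking \<theta> \<omega>))) \<partial>unif_seq)
    \<le> (\<Sum>j\<in>cell_tuples k N. c j *
      (ennreal (pick_weight k (lo N \<circ> j)) * ennreal (intensity_bound \<theta> \<alpha> \<beta> k (lo N \<circ> j) (hi N \<circ> j))))"
proof -
  let ?I = "\<lambda>j \<omega>. indicator {x. \<forall>i<k. x i \<in> cell N (j i)} (stick_breaking \<theta> \<omega>) :: ennreal"
  have I_eq: "?I j = (\<lambda>\<omega>. indicator {\<omega>. \<forall>i<k. stick_breaking \<theta> \<omega> i \<in> {(lo N \<circ> j) i<..(hi N \<circ> j) i}} \<omega>)" for j
    by (auto simp: fun_eq_iff indicator_def cell_def)
  have meas: "?I j \<in> borel_measurable unif_seq" for j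
    unfolding I_eq by measurable
  have meas': "(\<lambda>\<omega>. d * ?I j \<omega>) \<in> borel_measurable unif_seq"
    "(\<lambda>\<omega>. d' * (d * ?I j \<omega>)) \<in> borel_measurable unif_seq" for d d' j
    by (intro borel_measurable_times_ennreal borel_measurable_const meas)+
  have "(\<integral>\<^sup>+\<omega>. (\<Sum>j\<in>cell_tuples k N. c j * (ennreal (box_ratio \<theta> \<alpha> \<beta> k (lo N \<circ> j) (hi N \<circ> j)) * ?I j \<omega>)) \<partial>unif_seq)
    = (\<Sum>j\<in>cell_tuples k N. \<integral>\<^sup>+\<omega>. c j * (ennreal (box_ratio \<theta> \<alpha> \<beta> k (lo N \<circ> j) (hi N \<circ> j)) * ?I j \<omega>) \<partial>unif_seq)"
    by (intro nn_integral_sum meas')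
  also have "\<dots> = (\<Sum>j\<in>cell_tuples k N. c j * (ennreal (box_ratio \<theta> \<alpha> \<beta> k (lo N \<circ> j) (hi N \<circ> j)) * (\<integral>\<^sup>+\<omega>. ?I j \<omega> \<partial>unif_seq)))"
    by (simp only: nn_integral_cmult meas meas')
  also have "\<dots> \<le> (\<Sum>j\<in>cell_tuples k N. c j *
      (ennreal (pick_weight k (lo N \<circ> j)) * ennreal (intensity_bound \<theta> \<alpha> \<beta> k (lo N \<circ> j) (hi N \<circ> j))))"
  proof (intro sum_mono mult_left_mono)
    fix j assume j: "j \<in> cell_tuples k N"
    have "0 < (lo N \<circ> j) i \<and> (lo N \<circ> j) i < (hi N \<circ> j) i" if "i < k" for i
      using lo_pos[OF cell_tuples_mem[OF j that]] lo_less_hi[OF cell_tuples_mem[OF j that]] by simp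
    moreover have "(\<Sum>i<k. (hi N \<circ> j) i) < 1" using j by (simp add: cell_tuples_def)
    ultimately show "ennreal (box_ratio \<theta> \<alpha> \<beta> k (lo N \<circ> j) (hi N \<circ> j)) * (\<integral>\<^sup>+\<omega>. ?I j \<omega> \<partial>unif_seq)
      \<le> ennreal (pick_weight k (lo N \<circ> j)) * ennreal (intensity_bound \<theta> \<alpha> \<beta> k (lo N \<circ> j) (hi N \<circ> j))"
      unfolding I_eq by (intro box_ratio_mult_le[OF \<theta>]) auto
  qed simp
  finally show ?thesis .
qed

section \<open>Lower semicontinuity of expectations\<close>

text \<open>The cube is compact by Tychonoff, so \<open>f\<close> is uniformly continuous there for
  the product metric. Coordinatewise distance at most d/3 gives distance at most 2d/3 < d, because
  the metric weights (1/2)^n add up to 2.\<close>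

lemma uniform_continuity_unit_cube:
  fixes f :: "(nat \<Rightarrow> real) \<Rightarrow> real"
  assumes f: "continuous_on UNIV f" and \<delta>: "\<delta> > 0"
  shows "\<exists>\<eta>>0. \<forall>x y. (\<forall>i. x i \<in> {0..1}) \<longrightarrow> (\<forall>i. y i \<in> {0..1}) \<longrightarrow>
    (\<forall>i. \<bar>x i - y i\<bar> \<le> \<eta>) \<longrightarrow> \<bar>f x - f y\<bar> < \<delta>"
proof -
  let ?K = "{x :: nat \<Rightarrow> real. \<forall>i. x i \<in> {0..1}}"
  have "compactin (product_topology (\<lambda>i::nat. euclidean :: real topology) UNIV) (\<Pi>\<^sub>E i\<in>UNIV. {0..1})"
    by (simp add: compactin_PiE compactin_euclidean_iff)
  then have "compact (\<Pi>\<^sub>E i\<in>(UNIV::nat set). {0..1::real})"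
    by (simp add: euclidean_product_topology compactin_euclidean_iff)
  moreover have "(\<Pi>\<^sub>E i\<in>(UNIV::nat set). {0..1::real}) = ?K"
    by (auto simp: PiE_UNIV_domain)
  ultimately have "compact ?K" by simp
  then have "uniformly_continuous_on ?K f"
    using f by (intro compact_uniformly_continuous) (auto intro: continuous_on_subset)
  then obtain d where d: "d > 0" "\<forall>x\<in>?K. \<forall>x'\<in>?K. dist x' x < d \<longrightarrow> dist (f x') (f x) < \<delta>"
    using \<delta> unfolding uniformly_continuous_on_def by blast
  have "\<bar>f x - f y\<bar> < \<delta>"
    if x: "\<forall>i. x i \<in> {0..1}" and y: "\<forall>i. y i \<in> {0..1}" and close: "\<forall>i. \<bar>x i - y i\<bar> \<le> d / 3" for x y
  proof -
    have geo: "(\<lambda>n. (1 / 2) ^ n * (d / 3)) sums (2 * (d / 3))"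
      using geometric_sums[of "1 / 2 :: real"] by (intro sums_mult2) simp
    have le: "(1 / 2) ^ n * min (dist (x (from_nat n)) (y (from_nat n))) 1 \<le> (1 / 2) ^ n * (d / 3)" for n
      using close[rule_format, of "from_nat n"]
      by (intro mult_left_mono) (auto simp: dist_real_def min_def)
    have "summable (\<lambda>n. (1 / 2) ^ n * min (dist (x (from_nat n)) (y (from_nat n))) 1)"
      by (rule summable_comparison_test'[OF sums_summable[OF geo], of 0]) (use le in auto)
    then have "dist x y \<le> 2 * (d / 3)"
      unfolding dist_fun_def sums_unique[OF geo]
      by (intro suminf_le le sums_summable[OF geo])
    then have "dist x y < d" using d(1) by simp
    then have "dist (f x) (f y) < \<delta>" using d(2) x y by blast
    then show ?thesis by (simp only: dist_real_def)
  qed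
  moreover have "d / 3 > 0" using d(1) by simp
  ultimately show ?thesis by blast
qed

text \<open>At most one box contains the first \<open>k\<close> entries of \<open>x\<close>, since
  the cells are disjoint. The sum is therefore the infimum of \<open>F\<close> over that box times
  its \<open>box_ratio\<close>, or 0 if there is no such box.\<close>

abbreviation lower_step where
  "lower_step F \<theta> \<alpha> \<beta> k N x \<equiv> (\<Sum>j\<in>cell_tuples k N. (INF m\<in>occupied k N j. F m) *
     (ennreal (box_ratio \<theta> \<alpha> \<beta> k (lo N \<circ> j) (hi N \<circ> j)) *
        indicator {x. \<forall>i<k. x i \<in> cell N (j i)} x)) :: ennreal"

lemma cell_index:
  assumes "N > 0" "0 < u"
  shows "u \<in> cell N (nat (\<lceil>u * real N\<rceil> - 1))"
proof -
  have "\<lceil>u * real N\<rceil> \<ge> 1" using assms by simp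
  then show ?thesis using assms(1) by (simp add: mem_cell_iff)
qed

lemma hi_eq_lo_plus: "hi N c = lo N c + 1 / real N"
  by (simp add: hi_def lo_def add_divide_distrib)

lemma tendsto_cell_ends:
  assumes "\<And>N. N > 0 \<Longrightarrow> u \<in> cell N (c N)"
  shows "(\<lambda>N. lo N (c N)) \<longlonglongrightarrow> u" "(\<lambda>N. hi N (c N)) \<longlonglongrightarrow> u"
proof -
  have inv: "(\<lambda>N. 1 / real N) \<longlonglongrightarrow> 0" by (rule lim_1_over_n)
  have ev: "\<forall>\<^sub>F N in sequentially. u - 1 / real N \<le> lo N (c N) \<and> lo N (c N) \<le> u"
    using eventually_gt_at_top[of 0]
  proof eventually_elim
    case (elim N)
    then show ?case using assms[of N] by (auto simp: cell_def hi_eq_lo_plus)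
  qed
  show lo: "(\<lambda>N. lo N (c N)) \<longlonglongrightarrow> u"
  proof (rule tendsto_sandwich)
    show "(\<lambda>N. u - 1 / real N) \<longlonglongrightarrow> u" using tendsto_diff[OF tendsto_const[of u] inv] by simp
    show "(\<lambda>N. u) \<longlonglongrightarrow> u" by simp
  qed (use ev in \<open>auto elim: eventually_mono\<close>)
  show "(\<lambda>N. hi N (c N)) \<longlonglongrightarrow> u"
    using tendsto_add[OF lo inv] by (simp add: hi_eq_lo_plus)
qed

text \<open>Any element of \<open>m'\<close> found in a cell of the box is within the mesh 1/N of
  the corresponding \<open>x i\<close>, and both lists have sum at least that of the lower ends. So
  \<open>ranked_diff_le\<close> applies in both directions.\<close>

lemma ranked_close:
  fixes x :: "nat \<Rightarrow> real"
  assumes m: "multisubset m" "msum m \<le> 1" and m': "m' \<in> occupied k N j"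
    and j: "j \<in> cell_tuples k N" and N: "1 / real N \<le> \<eta>"
    and x: "inj_on x {..<k}" "\<And>i. i < k \<Longrightarrow> m (x i) \<noteq> 0" "\<And>i. i < k \<Longrightarrow> x i \<in> cell N (j i)"
    and sum: "1 - \<eta> \<le> (\<Sum>i<k. lo N (j i))"
  shows "\<bar>ranked m i - ranked m' i\<bar> \<le> \<eta>"
proof -
  have m'': "multisubset m'" "msum m' \<le> 1" using m' by (simp_all add: occupied_def)
  have "\<forall>i. \<exists>y. i < k \<longrightarrow> y \<in> cell N (j i) \<and> m' y \<noteq> 0"
    using m' unfolding occupied_def by blast
  then obtain x' where x': "\<And>i. i < k \<Longrightarrow> x' i \<in> cell N (j i)" "\<And>i. i < k \<Longrightarrow> m' (x' i) \<noteq> 0"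
    by metis
  have \<eta>: "\<eta> \<ge> 0" using N by (meson divide_nonneg_nonneg of_nat_0_le_iff order_trans zero_le_one)
  have inj': "inj_on x' {..<k}"
  proof (rule inj_onI)
    fix i l assume il: "i \<in> {..<k}" "l \<in> {..<k}" "x' i = x' l"
    have "j i = j l"
    proof (rule ccontr)
      assume "j i \<noteq> j l"
      then have "cell N (j i) \<inter> cell N (j l) = {}"
        using disjoint_cells[of N] cell_tuples_mem[OF j] il(1,2) unfolding disjoint_family_on_def by blast
      then show False using x'(1)[of i] x'(1)[of l] il by auto
    qed
    moreover have "inj_on j {..<k}" using j unfolding cell_tuples_def distinct_tuples_def by blast
    ultimately show "i = l" using il(1,2) by (meson inj_onD)
  qed
  have close: "\<bar>x i - x' i\<bar> \<le> \<eta>" if "i < k" for i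
    using x(3)[OF that] x'(1)[OF that] N by (auto simp: cell_def hi_eq_lo_plus)
  have "(\<Sum>i<k. lo N (j i)) \<le> (\<Sum>i<k. x i)" "(\<Sum>i<k. lo N (j i)) \<le> (\<Sum>i<k. x' i)"
    using x(3) x'(1) by (auto intro!: sum_mono simp: cell_def intro: less_imp_le)
  then have s: "1 - \<eta> \<le> (\<Sum>i<k. x i)" "1 - \<eta> \<le> (\<Sum>i<k. x' i)" using sum by linarith+
  have "ranked m i \<le> ranked m' i + \<eta>"
    by (rule ranked_diff_le[OF m m'' x(1,2) inj' x'(2) s(1) close \<eta>])
  moreover have "ranked m' i \<le> ranked m i + \<eta>"
    using close by (intro ranked_diff_le[OF m'' m inj' x'(2) x(1,2) s(2) _ \<eta>]) (auto simp: abs_minus_commute)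
  ultimately show ?thesis by linarith
qed

text \<open>Take \<open>k\<close> so large that the first \<open>k\<close> entries have sum above 1
  - \<eta>, then \<open>N\<close> so large that they lie in a box of \<open>cell_tuples\<close>
  whose lower ends still have sum above 1 - \<eta>. By \<open>ranked_close\<close> and uniform
  continuity the infimum over the box is at least \<open>f (ranked m) - \<delta>\<close>, and the
  ratio tends to 1.\<close>

lemma le_liminf_lower_step:
  fixes f :: "(nat \<Rightarrow> real) \<Rightarrow> real" and x :: "nat \<Rightarrow> real"
  assumes f: "continuous_on UNIV f"
    and ab: "\<alpha> + \<beta> = 1 - \<theta>"
    and m: "multisubset m" "msum m \<le> 1"
    and inj: "inj x" and mx: "\<And>i. m (x i) \<noteq> 0"
    and lt: "\<And>k. (\<Sum>i<k. x i) < 1" and lim: "(\<lambda>k. \<Sum>i<k. x i) \<longlonglongrightarrow> 1"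
  shows "ennreal (f (ranked m)) \<le> liminf (\<lambda>k. liminf (\<lambda>N.
    lower_step (\<lambda>m. ennreal (f (ranked m))) \<theta> \<alpha> \<beta> k N x))"
proof (rule ennreal_le_epsilon)
  fix \<delta> :: real assume \<delta>: "\<delta> > 0"
  \<comment> \<open>Truncation at 0 keeps products with \<open>y\<close> compatible with
    \<open>ennreal\<close>, while \<open>f (ranked m) \<le> y + \<delta>\<close> still
    holds.\<close>
  define y where "y = max 0 (f (ranked m) - \<delta>)"
  let ?F = "\<lambda>m. ennreal (f (ranked m))"
  obtain \<eta> where \<eta>: "\<eta> > 0" and unif: "\<And>x y. \<lbrakk>\<forall>i. x i \<in> {0..1}; \<forall>i. y i \<in> {0..1};
      \<forall>i. \<bar>x i - y i\<bar> \<le> \<eta>\<rbrakk> \<Longrightarrow> \<bar>f x - f y\<bar> < \<delta>"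
    using uniform_continuity_unit_cube[OF f \<delta>] by blast
  have pos: "0 < x i" for i
    using m(1) mx[of i] by (auto simp: multisubset_def)
  have "\<forall>\<^sub>F k in sequentially. 1 - \<eta> < (\<Sum>i<k. x i)"
    using lim \<eta> by (intro order_tendstoD) auto
  then have "\<forall>\<^sub>F k in sequentially. ennreal y \<le> liminf (\<lambda>N. lower_step ?F \<theta> \<alpha> \<beta> k N x)"
  proof eventually_elim
    case (elim k)
    define j where "j N = (\<lambda>i\<in>{..<k}. nat (\<lceil>x i * real N\<rceil> - 1))" for N
    have xcell: "x i \<in> cell N (j N i)" if "i < k" "N > 0" for i N
      using cell_index[OF that(2) pos[of i]] that(1) by (simp add: j_def)
    have lo: "(\<lambda>N. lo N (j N i)) \<longlonglongrightarrow> x i" and hi: "(\<lambda>N. hi N (j N i)) \<longlonglongrightarrow> x i" if "i < k" for i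
      using tendsto_cell_ends[of "x i" "\<lambda>N. j N i"] xcell[OF that] by auto
    let ?r = "\<lambda>N. box_ratio \<theta> \<alpha> \<beta> k (lo N \<circ> j N) (hi N \<circ> j N)"
    have ratio: "?r \<longlonglongrightarrow> 1"
      using lo hi pos lt by (intro tendsto_box_ratio[OF ab, where x = x]) auto
    have "\<forall>\<^sub>F N in sequentially. 0 < N \<and> 1 / real N < \<eta>"
      using order_tendstoD(2)[OF lim_1_over_n \<eta>] eventually_gt_at_top[of 0] by eventually_elim simp
    moreover have "\<forall>\<^sub>F N in sequentially. (\<Sum>i<k. hi N (j N i)) < 1"
      using tendsto_sum[of "{..<k}" "\<lambda>i N. hi N (j N i)" x] hi lt[of k]
      by (intro order_tendstoD(2)[of _ "\<Sum>i<k. x i"]) auto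
    moreover have "\<forall>\<^sub>F N in sequentially. 1 - \<eta> < (\<Sum>i<k. lo N (j N i))"
      using tendsto_sum[of "{..<k}" "\<lambda>i N. lo N (j N i)" x] lo elim
      by (intro order_tendstoD(1)[of _ "\<Sum>i<k. x i"]) auto
    moreover have "\<forall>\<^sub>F N in sequentially. \<forall>i\<in>{..<k}. 0 < lo N (j N i)"
      using lo pos by (intro eventually_ball_finite ballI order_tendstoD(1)) auto
    \<comment> \<open>Distinct entries have distinct limits of their lower ends, so they end up in
      different cells; this makes the tuple of cell indices injective.\<close>
    moreover have "\<forall>\<^sub>F N in sequentially. \<forall>i\<in>{..<k}. \<forall>l\<in>{..<k}. i \<noteq> l \<longrightarrow> lo N (j N i) - lo N (j N l) \<noteq> 0"
    proof (intro eventually_ball_finite ballI finite_lessThan)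
      fix i l assume il: "i \<in> {..<k}" "l \<in> {..<k}"
      show "\<forall>\<^sub>F N in sequentially. i \<noteq> l \<longrightarrow> lo N (j N i) - lo N (j N l) \<noteq> 0"
      proof (cases "i = l")
        case False
        then have "x i - x l \<noteq> 0" using inj by (auto dest: injD)
        then have "\<forall>\<^sub>F N in sequentially. lo N (j N i) - lo N (j N l) \<noteq> 0"
          using il by (intro tendsto_imp_eventually_ne[OF tendsto_diff[OF lo lo]]) auto
        then show ?thesis by (rule eventually_mono) simp
      qed simp
    qed
    ultimately have "\<forall>\<^sub>F N in sequentially. ennreal (y * ?r N) \<le> lower_step ?F \<theta> \<alpha> \<beta> k N x"
    proof eventually_elim
      case (elim N)
      have N: "N > 0" "1 / real N \<le> \<eta>" using elim(1) by auto
      have jC: "j N i \<in> {1..<N}" if "i < k" for i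
      proof -
        have "0 < lo N (j N i)" using elim(4) that by simp
        then have "1 \<le> j N i" by (cases "j N i") (auto simp: lo_def)
        moreover have "hi N (j N i) \<le> (\<Sum>i<k. hi N (j N i))"
          using that by (intro member_le_sum) (auto simp: hi_def)
        then have "hi N (j N i) < 1" using elim(2) by linarith
        then have "j N i < N" using N(1) by (simp add: hi_def divide_less_eq)
        ultimately show ?thesis by simp
      qed
      have "inj_on (j N) {..<k}"
      proof (rule inj_onI)
        fix i l assume il: "i \<in> {..<k}" "l \<in> {..<k}" "j N i = j N l"
        show "i = l"
        proof (rule ccontr)
          assume "i \<noteq> l"
          then have "lo N (j N i) - lo N (j N l) \<noteq> 0" using elim(5) il(1,2) by blast
          then show False by (simp add: il(3))
        qed
      qed
      moreover have "j N \<in> {..<k} \<rightarrow>\<^sub>E {1..<N}"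
        unfolding j_def restrict_PiE_iff using jC by (auto simp: j_def)
      ultimately have jJ: "j N \<in> cell_tuples k N"
        unfolding cell_tuples_def distinct_tuples_def using elim(2) by blast
      have "ennreal y \<le> (INF m'\<in>occupied k N (j N). ?F m')"
      proof (rule INF_greatest)
        fix m' assume m': "m' \<in> occupied k N (j N)"
        have cl: "\<bar>ranked m i - ranked m' i\<bar> \<le> \<eta>" for i
          using xcell N(1) elim(3) mx inj
          by (intro ranked_close[OF m m' jJ N(2), of x]) (auto intro: inj_on_subset)
        have ms': "multisubset m'" using m' by (simp add: occupied_def)
        have "\<bar>f (ranked m) - f (ranked m')\<bar> < \<delta>"
          using ranked_bounds[OF m(1)] ranked_bounds[OF ms'] cl by (intro unif) auto
        then have "f (ranked m) - \<delta> \<le> f (ranked m')" by linarith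
        then show "ennreal y \<le> ?F m'"
          unfolding y_def by (cases "f (ranked m) - \<delta> \<ge> 0") (simp_all add: ennreal_leI max_absorb1)
      qed
      then have "ennreal y * ennreal (?r N) \<le> (INF m'\<in>occupied k N (j N). ?F m') * (ennreal (?r N) *
          indicator {x. \<forall>i<k. x i \<in> cell N (j N i)} x)"
        using xcell N(1) by (intro mult_mono) (auto simp: indicator_def)
      also have "\<dots> \<le> lower_step ?F \<theta> \<alpha> \<beta> k N x"
        by (rule member_le_sum[OF jJ _ finite_cell_tuples]) simp
      finally show ?case by (simp add: y_def ennreal_mult')
    qed
    then have "liminf (\<lambda>N. ennreal (y * ?r N)) \<le> liminf (\<lambda>N. lower_step ?F \<theta> \<alpha> \<beta> k N x)"
      by (rule Liminf_mono)
    moreover have "(\<lambda>N. ennreal (y * ?r N)) \<longlonglongrightarrow> ennreal (y * 1)"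
      by (intro tendsto_ennrealI tendsto_intros ratio)
    then have "liminf (\<lambda>N. ennreal (y * ?r N)) = ennreal y"
      by (simp add: lim_imp_Liminf)
    ultimately show ?case by simp
  qed
  then have "ennreal y \<le> liminf (\<lambda>k. liminf (\<lambda>N. lower_step ?F \<theta> \<alpha> \<beta> k N x))"
    by (rule Liminf_bounded)
  moreover have "?F m \<le> ennreal (y + \<delta>)"
    by (rule ennreal_leI) (simp add: y_def)
  then have "?F m \<le> ennreal y + ennreal \<delta>"
    using \<delta> by (subst (asm) ennreal_plus) (simp_all add: y_def)
  ultimately show "?F m \<le> liminf (\<lambda>k. liminf (\<lambda>N. lower_step ?F \<theta> \<alpha> \<beta> k N x)) + ennreal \<delta>"
    by (meson add_right_mono order_trans)
qed

lemma measurable_lower_step: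
  "(\<lambda>\<omega>. lower_step F \<theta> \<alpha> \<beta> k N (stick_breaking \<theta>' \<omega>)) \<in> borel_measurable unif_seq"
proof -
  have meas: "(\<lambda>\<omega>. indicator {x. \<forall>i<k. x i \<in> cell N (j i)} (stick_breaking \<theta>' \<omega>) :: ennreal)
      \<in> borel_measurable unif_seq" for j
  proof -
    have "(\<lambda>\<omega>. indicator {\<omega>. \<forall>i<k. stick_breaking \<theta>' \<omega> i \<in> {lo N (j i)<..hi N (j i)}} \<omega> :: ennreal)
        \<in> borel_measurable unif_seq"
      by measurable
    also have "(\<lambda>\<omega>. indicator {\<omega>. \<forall>i<k. stick_breaking \<theta>' \<omega> i \<in> {lo N (j i)<..hi N (j i)}} \<omega>)
        = (\<lambda>\<omega>. indicator {x. \<forall>i<k. x i \<in> cell N (j i)} (stick_breaking \<theta>' \<omega>) :: ennreal)"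
      by (auto simp: fun_eq_iff indicator_def cell_def)
    finally show ?thesis .
  qed
  show ?thesis
    by (intro borel_measurable_sum borel_measurable_times_ennreal borel_measurable_const meas)
qed

text \<open>For each \<open>k\<close> and \<open>N\<close> the step function has integral at most
  the same right-hand side, so the two lower limits can be taken afterwards, independently of
  \<open>n\<close>.\<close>

lemma nn_integral_poisson_dirichlet_le_liminf:
  fixes f :: "(nat \<Rightarrow> real) \<Rightarrow> real" and A :: "nat \<Rightarrow> 'w \<Rightarrow> real \<Rightarrow> nat"
  assumes \<theta>: "\<theta> > 0" and ab: "\<alpha> + \<beta> = 1 - \<theta>"
    and A: "\<And>n. random_multisubset (M n) (A n)"
    and msum: "\<And>n. AE \<omega> in M n. msum (A n \<omega>) \<le> 1"
    and hyp: "\<And>k a b. k \<ge> 1 \<Longrightarrow> admissible_intervals k a b \<Longrightarrow>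
      ennreal (intensity_bound \<theta> \<alpha> \<beta> k a b)
        \<le> liminf (\<lambda>n. \<integral>\<^sup>+\<omega>. (\<Prod>i<k. mcount (A n \<omega>) {a i..b i}) \<partial>M n)"
    and f: "continuous_on UNIV f"
  shows "(\<integral>\<^sup>+\<omega>. ennreal (f (ranked (seq_multiset (stick_breaking \<theta> \<omega>)))) \<partial>unif_seq)
    \<le> liminf (\<lambda>n. \<integral>\<^sup>+\<omega>. ennreal (f (ranked (A n \<omega>))) \<partial>M n)" (is "_ \<le> ?X")
proof -
  let ?F = "\<lambda>m. ennreal (f (ranked m))"
  let ?h = "\<lambda>k N \<omega>. lower_step ?F \<theta> \<alpha> \<beta> k N (stick_breaking \<theta> \<omega>)"
  have bound: "(\<integral>\<^sup>+\<omega>. ?h k N \<omega> \<partial>unif_seq) \<le> ?X" if "k \<ge> 1" for k N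
    using nn_integral_lower_step_le[OF \<theta>] liminf_nn_integral_ge[OF A msum hyp[OF that]]
    by (rule order_trans)
  have "AE \<omega> in unif_seq. ?F (seq_multiset (stick_breaking \<theta> \<omega>))
      \<le> liminf (\<lambda>k. liminf (\<lambda>N. ?h k N \<omega>))"
    using AE_unif_seq_range AE_inj_stick_breaking[OF \<theta>] AE_sum_stick_breaking_tendsto[OF \<theta>]
  proof eventually_elim
    case (elim \<omega>)
    let ?x = "stick_breaking \<theta> \<omega>"
    have pos: "0 < ?x i" for i using elim(1) by (intro stick_breaking_pos[OF \<theta>]) auto
    have lt: "(\<Sum>i<k. ?x i) < 1" for k
    proof -
      have "0 < \<omega> j powr (1 / \<theta>)" for j using elim(1)[rule_format, of j] by simp
      then have "0 < (\<Prod>j<k. \<omega> j powr (1 / \<theta>))" by (intro prod_pos) simp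
      then show ?thesis by (simp add: sum_stick_breaking)
    qed
    have le: "?x i \<le> 1" for i
      using member_le_sum[of i "{..<Suc i}" ?x] pos lt[of "Suc i"] by (auto simp: less_imp_le)
    have range: "?x i \<in> {0<..1}" for i using pos le by simp
    show ?case
      using msum_seq_multiset_le[OF elim(2) range less_imp_le[OF lt]] seq_multiset_inj[OF elim(2) range] elim(2,3) lt
      by (intro le_liminf_lower_step[OF f ab multisubset_seq_multiset]) auto
  qed
  \<comment> \<open>The integral bound is available for \<open>k \<ge> 1\<close> only, hence the
    shift by one, which does not decrease the lower limit.\<close>
  moreover have "liminf (\<lambda>k. liminf (\<lambda>N. ?h k N \<omega>)) \<le> liminf (\<lambda>k. liminf (\<lambda>N. ?h (Suc k) N \<omega>))" for \<omega>
    using liminf_subseq_mono[of Suc "\<lambda>k. liminf (\<lambda>N. ?h k N \<omega>)"] by (simp add: strict_mono_def o_def)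
  ultimately have "AE \<omega> in unif_seq. ?F (seq_multiset (stick_breaking \<theta> \<omega>))
      \<le> liminf (\<lambda>k. liminf (\<lambda>N. ?h (Suc k) N \<omega>))"
    by (blast intro: eventually_mono order_trans)
  then have "(\<integral>\<^sup>+\<omega>. ?F (seq_multiset (stick_breaking \<theta> \<omega>)) \<partial>unif_seq)
      \<le> (\<integral>\<^sup>+\<omega>. liminf (\<lambda>k. liminf (\<lambda>N. ?h (Suc k) N \<omega>)) \<partial>unif_seq)"
    by (rule nn_integral_mono_AE)
  also have "\<dots> \<le> liminf (\<lambda>k. \<integral>\<^sup>+\<omega>. liminf (\<lambda>N. ?h (Suc k) N \<omega>) \<partial>unif_seq)"
    by (intro nn_integral_liminf borel_measurable_liminf measurable_lower_step)
  also have "\<dots> \<le> liminf (\<lambda>k. liminf (\<lambda>N. \<integral>\<^sup>+\<omega>. ?h (Suc k) N \<omega> \<partial>unif_seq))"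
    by (intro Liminf_mono always_eventually allI nn_integral_liminf measurable_lower_step)
  also have "\<dots> \<le> liminf (\<lambda>k::nat. liminf (\<lambda>N::nat. ?X))"
    by (intro Liminf_mono always_eventually allI bound) simp
  also have "\<dots> = ?X" by (simp add: Liminf_const)
  finally show ?thesis .
qed

section \<open>From one-sided bounds to weak convergence\<close>

lemma seq_weak_convI:
  fixes \<mu> :: "nat \<Rightarrow> (nat \<Rightarrow> real) measure"
  assumes \<mu>: "\<And>n. prob_space (\<mu> n)" "\<And>n. sets (\<mu> n) = sets (\<Pi>\<^sub>M i\<in>UNIV. borel)"
    and \<nu>: "prob_space \<nu>" "sets \<nu> = sets (\<Pi>\<^sub>M i\<in>UNIV. borel)"
    and le: "\<And>f :: (nat \<Rightarrow> real) \<Rightarrow> real. continuous_on UNIV f \<Longrightarrow>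
      (\<integral>\<^sup>+x. ennreal (f x) \<partial>\<nu>) \<le> liminf (\<lambda>n. \<integral>\<^sup>+x. ennreal (f x) \<partial>\<mu> n)"
  shows "seq_weak_conv \<mu> \<nu>"
  unfolding seq_weak_conv_def
proof (intro allI impI, elim conjE)
  fix f :: "(nat \<Rightarrow> real) \<Rightarrow> real"
  assume f: "continuous_on UNIV f" and "bounded (range f)"
  then obtain C where C: "\<And>x. \<bar>f x\<bar> \<le> C" by (auto simp: bounded_iff)
  have lower: "\<forall>\<^sub>F n in sequentially. y < integral\<^sup>L (\<mu> n) g"
    if g: "continuous_on UNIV g" and Cg: "\<And>x. \<bar>g x\<bar> \<le> C" and y: "y < integral\<^sup>L \<nu> g" for g y
  proof -
    \<comment> \<open>Adding \<open>C\<close> makes the integrand nonnegative, so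
      \<open>ennreal\<close> truncates nothing and the two kinds of integral agree.\<close>
    have eq: "(\<integral>\<^sup>+x. ennreal (C + g x) \<partial>\<rho>) = ennreal (C + integral\<^sup>L \<rho> g) \<and> 0 \<le> C + integral\<^sup>L \<rho> g"
      if \<rho>: "prob_space \<rho>" "sets \<rho> = sets (\<Pi>\<^sub>M i\<in>UNIV. borel)" for \<rho> :: "(nat \<Rightarrow> real) measure"
    proof -
      interpret prob_space \<rho> by fact
      have meas: "g \<in> borel_measurable \<rho>"
        using borel_measurable_continuous_onI[OF g] \<rho>(2)
        by (metis measurable_cong_sets sets_PiM_equal_borel)
      then have int: "integrable \<rho> g"
        using Cg by (intro integrable_const_bound[of _ C]) auto
      have nonneg: "0 \<le> C + g x" for x using Cg[of x] by linarith
      have "(\<integral>\<^sup>+x. ennreal (C + g x) \<partial>\<rho>) = ennreal (\<integral>x. C + g x \<partial>\<rho>)"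
        using int nonneg by (intro nn_integral_eq_integral) auto
      moreover have "(\<integral>x. C + g x \<partial>\<rho>) = C + integral\<^sup>L \<rho> g"
        using int prob_space by simp
      moreover have "0 \<le> (\<integral>x. C + g x \<partial>\<rho>)" using nonneg by simp
      ultimately show ?thesis by simp
    qed
    show ?thesis
    proof (cases "0 \<le> C + y")
      case True
      have "ennreal (C + y) < ennreal (C + integral\<^sup>L \<nu> g)"
        using y True by (intro ennreal_lessI) auto
      also have "\<dots> \<le> liminf (\<lambda>n. ennreal (C + integral\<^sup>L (\<mu> n) g))"
        using le[of "\<lambda>x. C + g x"] g eq[OF \<nu>] eq[OF \<mu>] by (simp add: continuous_on_add)
      finally have "\<forall>\<^sub>F n in sequentially. ennreal (C + y) < ennreal (C + integral\<^sup>L (\<mu> n) g)"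
        by (rule less_LiminfD)
      then show ?thesis
        by (rule eventually_mono) (use True in \<open>simp add: ennreal_less_iff\<close>)
    next
      case False
      \<comment> \<open>Here y < -C, which lies below every integral of a function bounded by
        \<open>C\<close> in absolute value.\<close>
      have "y < integral\<^sup>L (\<mu> n) g" for n using eq[OF \<mu>(1,2), of n] False by linarith
      then show ?thesis by simp
    qed
  qed
  show "(\<lambda>n. integral\<^sup>L (\<mu> n) f) \<longlonglongrightarrow> integral\<^sup>L \<nu> f"
  proof (rule order_tendstoI)
    fix y assume "y < integral\<^sup>L \<nu> f"
    then show "\<forall>\<^sub>F n in sequentially. y < integral\<^sup>L (\<mu> n) f" using lower[OF f C] by blast
  next
    fix y assume y: "integral\<^sup>L \<nu> f < y"
    have "\<forall>\<^sub>F n in sequentially. - y < integral\<^sup>L (\<mu> n) (\<lambda>x. - f x)"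
      using f C y by (intro lower) (auto intro: continuous_on_minus)
    then show "\<forall>\<^sub>F n in sequentially. integral\<^sup>L (\<mu> n) f < y" by simp
  qed
qed

lemma seq_weak_conv_poisson_dirichlet:
  fixes A :: "nat \<Rightarrow> 'w \<Rightarrow> real \<Rightarrow> nat"
  assumes \<theta>: "\<theta> > 0" and prob: "\<And>n. prob_space (M n)"
    and A: "\<And>n. random_multisubset (M n) (A n)"
    and msum: "\<And>n. \<P>(\<omega> in M n. msum (A n \<omega>) \<le> 1) = 1"
    and ab: "\<alpha> + \<beta> = 1 - \<theta>"
    and hyp: "\<And>k a b. k \<ge> 1 \<Longrightarrow> admissible_intervals k a b \<Longrightarrow>
      ennreal (intensity_bound \<theta> \<alpha> \<beta> k a b)
        \<le> liminf (\<lambda>n. \<integral>\<^sup>+\<omega>. (\<Prod>i<k. mcount (A n \<omega>) {a i..b i}) \<partial>M n)"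
  shows "seq_weak_conv (\<lambda>n. distr (M n) (\<Pi>\<^sub>M i\<in>UNIV. borel) (\<lambda>\<omega>. ranked (A n \<omega>))) (poisson_dirichlet \<theta>)"
proof (rule seq_weak_convI)
  have AE: "AE \<omega> in M n. msum (A n \<omega>) \<le> 1" for n
  proof -
    \<comment> \<open>A set outside the sigma-algebra has measure 0 by convention, so probability 1
      itself shows that this set is an event.\<close>
    have "{\<omega> \<in> space (M n). msum (A n \<omega>) \<le> 1} \<in> sets (M n)"
      using msum[of n] measure_notin_sets by fastforce
    from prob_space.prob_Collect_eq_1[OF prob this] show ?thesis
      using msum[of n] by simp
  qed
  have meas: "(\<lambda>\<omega>. ranked (A n \<omega>)) \<in> measurable (M n) (\<Pi>\<^sub>M i\<in>UNIV. borel)" for n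
    using A[of n] by (intro ranked_measurable) (auto simp: random_multisubset_def)
  show "prob_space (distr (M n) (\<Pi>\<^sub>M i\<in>UNIV. borel) (\<lambda>\<omega>. ranked (A n \<omega>)))" for n
    by (rule prob_space.prob_space_distr[OF prob meas])
  show "prob_space (poisson_dirichlet \<theta>)"
    unfolding poisson_dirichlet_def
    by (rule unif_seq.P.prob_space_distr[OF measurable_ranked_stick_breaking])
  show "sets (distr (M n) (\<Pi>\<^sub>M i\<in>UNIV. borel) (\<lambda>\<omega>. ranked (A n \<omega>))) = sets (\<Pi>\<^sub>M i\<in>UNIV. borel)" for n
    by simp
  show "sets (poisson_dirichlet \<theta>) = sets (\<Pi>\<^sub>M i\<in>UNIV. borel)"
    by (simp add: poisson_dirichlet_def)
  fix f :: "(nat \<Rightarrow> real) \<Rightarrow> real" assume f: "continuous_on UNIV f"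
  have "f \<in> borel_measurable (\<Pi>\<^sub>M i\<in>UNIV. borel)"
    using borel_measurable_continuous_onI[OF f] by (metis measurable_cong_sets sets_PiM_equal_borel)
  then have fm: "(\<lambda>x. ennreal (f x)) \<in> borel_measurable (distr N (\<Pi>\<^sub>M i\<in>UNIV. borel) X)"
    for N :: "'c measure" and X
    by simp
  show "(\<integral>\<^sup>+x. ennreal (f x) \<partial>poisson_dirichlet \<theta>)
    \<le> liminf (\<lambda>n. \<integral>\<^sup>+x. ennreal (f x) \<partial>distr (M n) (\<Pi>\<^sub>M i\<in>UNIV. borel) (\<lambda>\<omega>. ranked (A n \<omega>)))"
    unfolding poisson_dirichlet_def nn_integral_distr[OF meas fm]
      nn_integral_distr[OF measurable_ranked_stick_breaking fm]
    by (rule nn_integral_poisson_dirichlet_le_liminf[OF \<theta> ab A AE hyp f])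
qed

theorem lemma3:
  fixes \<theta> \<alpha> \<beta> :: real
    and M :: "nat \<Rightarrow> 'w measure"
    and A :: "nat \<Rightarrow> 'w \<Rightarrow> real \<Rightarrow> nat"
  assumes "\<theta> > 0"
    and "\<And>n. prob_space (M n)"
    and "\<And>n. random_multisubset (M n) (A n)"
    and "\<And>n. \<P>(\<omega> in M n. msum (A n \<omega>) \<le> 1) = 1"
    and "\<alpha> + \<beta> = 1 - \<theta>"
  shows
    "((\<forall>k\<ge>1. \<forall>a b. admissible_intervals k a b \<longrightarrow>
         liminf (\<lambda>n. \<integral>\<^sup>+\<omega>. (\<Prod>i<k. mcount (A n \<omega>) {a i..b i}) \<partial>M n) \<ge>
           ennreal (\<theta> ^ k / ((1 - (\<Sum>i<k. a i)) powr \<alpha> * (1 - (\<Sum>i<k. b i)) powr \<beta>)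
             * (\<Prod>i<k. (b i - a i) / b i)))
       \<longrightarrow> seq_weak_conv (\<lambda>n. distr (M n) (\<Pi>\<^sub>M i\<in>UNIV. borel) (\<lambda>\<omega>. ranked (A n \<omega>)))
             (poisson_dirichlet \<theta>))
     \<and>
     ((\<forall>k\<ge>1. \<forall>a b. admissible_intervals k a b \<longrightarrow>
         liminf (\<lambda>n. \<integral>\<^sup>+\<omega>. (\<Prod>i<k. mcount (A n \<omega>) {a i..b i}) \<partial>M n) \<ge>
           ennreal (\<theta> ^ k / ((1 - (\<Sum>i<k. a i)) powr \<alpha> * (1 - (\<Sum>i<k. b i)) powr \<beta>)
             * (\<Prod>i<k. ln (b i / a i))))
       \<longrightarrow> seq_weak_conv (\<lambda>n. distr (M n) (\<Pi>\<^sub>M i\<in>UNIV. borel) (\<lambda>\<omega>. ranked (A n \<omega>)))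
             (poisson_dirichlet \<theta>))"
proof (intro conjI impI)
  assume hyp: "\<forall>k\<ge>1. \<forall>a b. admissible_intervals k a b \<longrightarrow>
         liminf (\<lambda>n. \<integral>\<^sup>+\<omega>. (\<Prod>i<k. mcount (A n \<omega>) {a i..b i}) \<partial>M n) \<ge>
           ennreal (\<theta> ^ k / ((1 - (\<Sum>i<k. a i)) powr \<alpha> * (1 - (\<Sum>i<k. b i)) powr \<beta>)
             * (\<Prod>i<k. (b i - a i) / b i))"
  show "seq_weak_conv (\<lambda>n. distr (M n) (\<Pi>\<^sub>M i\<in>UNIV. borel) (\<lambda>\<omega>. ranked (A n \<omega>))) (poisson_dirichlet \<theta>)"
    by (rule seq_weak_conv_poisson_dirichlet[OF assms])
       (use hyp in \<open>auto simp: intensity_bound_def\<close>)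
next
  assume hyp: "\<forall>k\<ge>1. \<forall>a b. admissible_intervals k a b \<longrightarrow>
         liminf (\<lambda>n. \<integral>\<^sup>+\<omega>. (\<Prod>i<k. mcount (A n \<omega>) {a i..b i}) \<partial>M n) \<ge>
           ennreal (\<theta> ^ k / ((1 - (\<Sum>i<k. a i)) powr \<alpha> * (1 - (\<Sum>i<k. b i)) powr \<beta>)
             * (\<Prod>i<k. ln (b i / a i)))"
  show "seq_weak_conv (\<lambda>n. distr (M n) (\<Pi>\<^sub>M i\<in>UNIV. borel) (\<lambda>\<omega>. ranked (A n \<omega>))) (poisson_dirichlet \<theta>)"
  proof (rule seq_weak_conv_poisson_dirichlet[OF assms])
    fix k :: nat and a b :: "nat \<Rightarrow> real"
    assume k: "1 \<le> k" and adm: "admissible_intervals k a b"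
    \<comment> \<open>The elementary inequality ln t \<le> t - 1 at t = a/b gives 1 - a/b \<le> ln
      (b/a), so the logarithmic bound implies the other one.\<close>
    have "(\<Prod>i<k. (b i - a i) / b i) \<le> (\<Prod>i<k. ln (b i / a i))"
    proof (rule prod_mono)
      fix i assume "i \<in> {..<k}"
      then have i: "0 < a i" "a i \<le> b i" using adm by (auto simp: admissible_intervals_def)
      have "(b i - a i) / b i = 1 - a i / b i" using i by (simp add: diff_divide_distrib)
      also have "\<dots> \<le> - ln (a i / b i)" using ln_le_minus_one[of "a i / b i"] i by simp
      also have "\<dots> = ln (b i / a i)" using i by (simp add: ln_div)
      finally show "0 \<le> (b i - a i) / b i \<and> (b i - a i) / b i \<le> ln (b i / a i)" using i by simp
    qed
    then have "intensity_bound \<theta> \<alpha> \<beta> k a b \<le>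
        \<theta> ^ k / ((1 - (\<Sum>i<k. a i)) powr \<alpha> * (1 - (\<Sum>i<k. b i)) powr \<beta>) * (\<Prod>i<k. ln (b i / a i))"
      unfolding intensity_bound_def using assms(1) by (intro mult_left_mono) auto
    then have "ennreal (intensity_bound \<theta> \<alpha> \<beta> k a b) \<le>
        ennreal (\<theta> ^ k / ((1 - (\<Sum>i<k. a i)) powr \<alpha> * (1 - (\<Sum>i<k. b i)) powr \<beta>) * (\<Prod>i<k. ln (b i / a i)))"
      by (rule ennreal_leI)
    also have "\<dots> \<le> liminf (\<lambda>n. \<integral>\<^sup>+\<omega>. (\<Prod>i<k. mcount (A n \<omega>) {a i..b i}) \<partial>M n)"
      using hyp k adm by blast
    finally show "ennreal (intensity_bound \<theta> \<alpha> \<beta> k a b)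
        \<le> liminf (\<lambda>n. \<integral>\<^sup>+\<omega>. (\<Prod>i<k. mcount (A n \<omega>) {a i..b i}) \<partial>M n)" .
  qed
qed

end
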